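(* Let $N,n\in\mathbb N$ with $2\le n\le N$ and let $Z=(z_{j,r})\in\mathbb C^{N\times n}$ (no boundedness assumption on the entries). Put $\widetilde z_r=\frac1N\sum_{j=1}^N z_{j,r}$ for $r\in[n]$, $y_{u,v,r}=z_{u,r}-z_{v,r}$, and $$\beta=\frac1n\sum_{r=1}^n|\widetilde z_r|^2,\qquad \vartheta=\frac{1}{N(N-1)\sqrt{n(n-1)}}\Big(\sum_{(r,s)\in[n]^2_{\neq}}\Big(\sum_{(u,v)\in[N]^2_{\neq}}|y_{u,v,r}\,y_{u,v,s}|\Big)^2\Big)^{1/2},$$ $$\kappa=\begin{cases}\dfrac{1}{(n-2)(N-2)}\displaystyle\max_{(u,v)\in[N]^2_{\neq},\,(r,s)\in[n]^2_{\neq}}\ \sum_{j\in[N]\setminus\{u,v\}}\ \sum_{\ell\in[n]\setminus\{r,s\}}|z_{j,\ell}|^2, & n\ge3,\\[2mm] 1,& n=2,\end{cases}$$ and $f_n(x_1,x_2)=\sum_{k=2}^n(k-1)x_1^{n-k}x_2^{k-2}$ for $x_1,x_2\in\mathbb R$. Then $$\Big|\frac{(N-n)!}{N!}\operatorname{Per}(Z)-\prod_{r=1}^n\widetilde z_r\Big|\le\frac{\vartheta}{2N}\,f_n\big(\sqrt\beta,\sqrt\kappa\big).$$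
   Context: $[m]=\{1,\dots,m\}$. $[N]^n_{\neq}$ denotes the set of injective maps $j:[n]\to[N]$, written as tuples $(j_1,\dots,j_n)$; in particular $[N]^2_{\neq}=\{(u,v)\in[N]^2: u\ne v\}$. The permanent of the rectangular matrix $Z$ is $\operatorname{Per}(Z)=\sum_{j\in[N]^n_{\neq}}\prod_{r=1}^n z_{j_r,r}$. Convention $0^0=1$. *)

theory Defs
  imports Complex_Main "HOL-Library.FuncSet"
begin

text \<open>
  An \<open>N \<times> n\<close> complex matrix is a function \<open>Z\<close> of type \<open>nat \<Rightarrow> nat \<Rightarrow> complex\<close>, with
  \<open>Z j r\<close> the entry in row \<open>j\<close> and column \<open>r\<close>. Only the entries with \<open>j \<in> {1..N}\<close> and
  \<open>r \<in> {1..n}\<close> are ever used.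
\<close>

definition inj_tuples :: "nat \<Rightarrow> nat \<Rightarrow> (nat \<Rightarrow> nat) set" where
  "inj_tuples N n = {j \<in> {1..n} \<rightarrow>\<^sub>E {1..N}. inj_on j {1..n}}"

text \<open>The case of 2-tuples, written as pairs.\<close>

definition neq_pairs :: "nat \<Rightarrow> (nat \<times> nat) set" where
  "neq_pairs N = {(u, v). u \<in> {1..N} \<and> v \<in> {1..N} \<and> u \<noteq> v}"

definition Per :: "nat \<Rightarrow> nat \<Rightarrow> (nat \<Rightarrow> nat \<Rightarrow> complex) \<Rightarrow> complex" where
  "Per N n Z = (\<Sum>j\<in>inj_tuples N n. \<Prod>r=1..n. Z (j r) r)"

definition col_mean :: "nat \<Rightarrow> (nat \<Rightarrow> nat \<Rightarrow> complex) \<Rightarrow> nat \<Rightarrow> complex" where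
  "col_mean N Z r = 1 / of_nat N * (\<Sum>j=1..N. Z j r)"

definition row_diff :: "(nat \<Rightarrow> nat \<Rightarrow> complex) \<Rightarrow> nat \<Rightarrow> nat \<Rightarrow> nat \<Rightarrow> complex" where
  "row_diff Z u v r = Z u r - Z v r"

definition beta :: "nat \<Rightarrow> nat \<Rightarrow> (nat \<Rightarrow> nat \<Rightarrow> complex) \<Rightarrow> real" where
  "beta N n Z = 1 / real n * (\<Sum>r=1..n. (cmod (col_mean N Z r))\<^sup>2)"

definition vartheta :: "nat \<Rightarrow> nat \<Rightarrow> (nat \<Rightarrow> nat \<Rightarrow> complex) \<Rightarrow> real" where
  "vartheta N n Z =
     1 / (real N * (real N - 1) * sqrt (real n * (real n - 1))) *
     sqrt (\<Sum>(r, s)\<in>neq_pairs n.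
             (\<Sum>(u, v)\<in>neq_pairs N. cmod (row_diff Z u v r * row_diff Z u v s))\<^sup>2)"

text \<open>
  \<open>Max\<close> is only meaningful on finite nonempty sets; for \<open>3 \<le> n \<le> N\<close> this is the case here.
\<close>

definition kappa :: "nat \<Rightarrow> nat \<Rightarrow> (nat \<Rightarrow> nat \<Rightarrow> complex) \<Rightarrow> real" where
  "kappa N n Z =
     (if n \<ge> 3 then
        1 / ((real n - 2) * (real N - 2)) *
        Max ((\<lambda>((u, v), (r, s)). \<Sum>j\<in>{1..N} - {u, v}. \<Sum>l\<in>{1..n} - {r, s}. (cmod (Z j l))\<^sup>2)
             ` (neq_pairs N \<times> neq_pairs n))
      else 1)"

text \<open>Recall that \<open>0 ^ 0 = 1\<close>.\<close>

definition f_poly :: "nat \<Rightarrow> real \<Rightarrow> real \<Rightarrow> real" where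
  "f_poly n x1 x2 = (\<Sum>k=2..n. (real k - 1) * x1 ^ (n - k) * x2 ^ (k - 2))"

end

theory Submission
  imports Defs "HOL-Combinatorics.Transposition" "HOL-Analysis.L2_Norm"
begin

text \<open>
  Let \<open>T k\<close> be the average over the \<open>k\<close>-subsets \<open>S\<close> of the columns of the normalised permanent of the
  columns in \<open>S\<close> times the product of the means of the other columns, so that \<open>T 0 = T 1\<close> is the
  product of all column means and \<open>T n\<close> is the normalised permanent. In \<open>T k - T (k - 1)\<close> one compares
  drawing a row without replacement with drawing it independently; symmetrising under the exchange of
  two drawn rows \<open>u\<close>, \<open>v\<close> turns the difference into an average of products
  \<open>y u v r * y u v s\<close> times normalised permanents of the remaining \<open>k - 2\<close> columns.
  These permanents satisfy the Hadamard type inequality of Carlen, Lieb and Loss, i.e. they are at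
  most the product of the quadratic means of the columns. Both this and Maclaurin's inequality, which
  handles the average over subsets, follow by smoothing: replacing two rows by convex combinations of
  them increases the functional. Two applications of the Cauchy-Schwarz inequality, over the subsets
  and over the pairs \<open>(r, s)\<close>, finish the estimate.
\<close>

section \<open>Sums over injections\<close>

text \<open>Arbitrary sets of rows and columns take the place of intervals, because the proof keeps
  deleting rows and columns. Extensionality makes the set finite and leaves exactly one map on the
  empty set.\<close>

definition inj_maps :: "'b set \<Rightarrow> 'a set \<Rightarrow> ('b \<Rightarrow> 'a) set" where
  "inj_maps L A = {J \<in> L \<rightarrow>\<^sub>E A. inj_on J L}"

lemma finite_inj_maps [simp]: "finite L \<Longrightarrow> finite A \<Longrightarrow> finite (inj_maps L A)"
  by (simp add: inj_maps_def finite_PiE)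

lemma inj_maps_empty [simp]: "inj_maps {} A = {\<lambda>_. undefined}"
  by (auto simp: inj_maps_def)

text \<open>Splits \<open>J\<close> into its value \<open>j\<close> at \<open>x\<close> and the
  rest. With \<open>j\<close> chosen first, the other columns see the rows \<open>A - {j}\<close>:
  expansion of a permanent along column \<open>x\<close>.\<close>

lemma sum_inj_maps_insert:
  assumes "finite L" "finite A" "x \<notin> L"
  shows "(\<Sum>J\<in>inj_maps (insert x L) A. g J) =
         (\<Sum>j\<in>A. \<Sum>J\<in>inj_maps L (A - {j}). g (J(x := j)))"
proof -
  have "(\<Sum>J\<in>inj_maps (insert x L) A. g J) =
        (\<Sum>(j, J)\<in>Sigma A (\<lambda>j. inj_maps L (A - {j})). g (J(x := j)))"
  proof (rule sum.reindex_bij_witness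
          [where i = "\<lambda>(j, J). J(x := j)" and j = "\<lambda>J. (J x, J(x := undefined))"])
    fix J assume J: "J \<in> inj_maps (insert x L) A"
    have mem: "J l \<in> A" if "l \<in> insert x L" for l
      using J that unfolding inj_maps_def by blast
    have neq: "J l \<noteq> J x" if "l \<in> L" for l
      using J that assms(3) unfolding inj_maps_def inj_on_def by blast
    have upd: "(J(x := undefined)) l = J l" if "l \<in> L" for l
      using that assms(3) by auto
    have "J(x := undefined) \<in> L \<rightarrow>\<^sub>E A - {J x}"
    proof (rule PiE_I)
      show "(J(x := undefined)) l \<in> A - {J x}" if "l \<in> L" for l
        using that mem neq unfolding upd[OF that] by blast
      show "(J(x := undefined)) l = undefined" if "l \<notin> L" for l
      proof -
        have "J \<in> insert x L \<rightarrow>\<^sub>E A" using J unfolding inj_maps_def by blast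
        then show ?thesis using that PiE_arb[of J "insert x L" "\<lambda>_. A" l] by (cases "l = x") simp_all
      qed
    qed
    moreover have "inj_on (J(x := undefined)) L = inj_on J L"
      by (rule inj_on_cong) (rule upd)
    then have "inj_on (J(x := undefined)) L"
      using J by (simp add: inj_maps_def)
    ultimately show "(J x, J(x := undefined)) \<in> Sigma A (\<lambda>j. inj_maps L (A - {j}))"
      using mem by (simp add: inj_maps_def)
  next
    fix p assume "p \<in> Sigma A (\<lambda>j. inj_maps L (A - {j}))"
    then obtain j J where p: "p = (j, J)" "j \<in> A" "J \<in> inj_maps L (A - {j})" by auto
    then have J: "J \<in> L \<rightarrow>\<^sub>E A - {j}" "inj_on J L" by (auto simp: inj_maps_def)
    have upd: "(J(x := j)) l = J l" if "l \<in> L" for l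
      using that assms(3) by auto
    have "J(x := j) \<in> insert x L \<rightarrow>\<^sub>E A"
    proof (rule PiE_I)
      show "(J(x := j)) l \<in> A" if "l \<in> insert x L" for l
        using that p(2) PiE_mem[OF J(1), of l] by (cases "l = x") simp_all
      show "(J(x := j)) l = undefined" if "l \<notin> insert x L" for l
        using that PiE_arb[OF J(1), of l] by simp
    qed
    moreover have "inj_on (J(x := j)) L = inj_on J L"
      by (rule inj_on_cong) (rule upd)
    then have "inj_on (J(x := j)) L"
      using J(2) by simp
    moreover have "(J(x := j)) x \<notin> (J(x := j)) ` (L - {x})"
      using PiE_mem[OF J(1)] assms(3) by fastforce
    ultimately show "(case p of (j, J) \<Rightarrow> J(x := j)) \<in> inj_maps (insert x L) A"
      unfolding p(1) prod.case inj_maps_def by (simp only: inj_on_insert mem_Collect_eq simp_thms)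
    show "((case p of (j, J) \<Rightarrow> J(x := j)) x, (case p of (j, J) \<Rightarrow> J(x := j))(x := undefined)) = p"
    proof -
      have "J x = undefined" by (rule PiE_arb[OF J(1) assms(3)])
      then have "J(x := undefined) = J" by (rule fun_upd_idem)
      then show ?thesis unfolding p(1) by simp
    qed
  qed (simp_all only: prod.case fun_upd_upd fun_upd_triv)
  then show ?thesis
    using assms by (simp add: sum.Sigma)
qed

text \<open>The same expansion with the row of \<open>x\<close> drawn last, from the rows that
  \<open>J\<close> leaves free. The two orders of summation are exchanged under the condition that
  \<open>J\<close> misses \<open>j\<close>.\<close>

lemma sum_inj_maps_insert':
  fixes L :: "'b set" and A :: "'a set"
  assumes "finite L" "finite A" "x \<notin> L"
  shows "(\<Sum>J\<in>inj_maps (insert x L) A. g J) =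
         (\<Sum>J\<in>inj_maps L A. \<Sum>j\<in>A - J ` L. g (J(x := j)))"
proof -
  have "inj_maps L (A - {j}) = {J \<in> inj_maps L A. j \<notin> J ` L}" for j
    by (auto simp: inj_maps_def PiE_def Pi_def)
  moreover have "A - J ` L = {j \<in> A. j \<notin> J ` L}" for J
    by auto
  ultimately show ?thesis
    unfolding sum_inj_maps_insert[OF assms] using assms
    by (simp only:) (intro sum.swap_restrict; simp)
qed

lemma card_inj_maps_insert:
  assumes "finite L" "finite A" "x \<notin> L"
  shows "card (inj_maps (insert x L) A) = card (inj_maps L A) * (card A - card L)"
proof -
  have "card (inj_maps (insert x L) A) = (\<Sum>J\<in>inj_maps (insert x L) A. 1)"
    by simp
  also have "\<dots> = (\<Sum>J\<in>inj_maps L A. card (A - J ` L))"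
    by (subst sum_inj_maps_insert'[OF assms]) simp
  also have "\<dots> = (\<Sum>J\<in>inj_maps L A. card A - card L)"
  proof (intro sum.cong refl)
    fix J assume "J \<in> inj_maps L A"
    then have "J ` L \<subseteq> A" "card (J ` L) = card L"
      by (auto simp: inj_maps_def card_image)
    then show "card (A - J ` L) = card A - card L"
      using assms by (simp add: card_Diff_subset)
  qed
  finally show ?thesis by simp
qed

lemma card_inj_maps:
  assumes "finite L" "finite A" "card L \<le> card A"
  shows "card (inj_maps L A) * fact (card A - card L) = fact (card A)"
  using assms(1,3)
proof (induction L rule: finite_induct)
  case (insert x L)
  then have "fact (card A - card L) = (card A - card L) * fact (card A - card (insert x L))"
    by (simp add: fact_reduce)
  then show ?case
    using insert assms(2) by (simp add: card_inj_maps_insert algebra_simps)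
qed simp

lemma card_inj_maps_pos:
  assumes "finite L" "finite A" "card L \<le> card A"
  shows "card (inj_maps L A) > 0"
  using card_inj_maps[OF assms] by (cases "card (inj_maps L A)") auto

lemma sum_inj_maps_transpose:
  assumes "i \<in> L" "s \<in> L"
  shows "(\<Sum>J\<in>inj_maps L A. g (J \<circ> transpose i s)) = (\<Sum>J\<in>inj_maps L A. g J)"
proof (rule sum.reindex_bij_witness[where i = "\<lambda>J. J \<circ> transpose i s" and j = "\<lambda>J. J \<circ> transpose i s"])
  have tr: "transpose i s l \<in> L \<longleftrightarrow> l \<in> L" for l
    using assms by (auto simp: transpose_def)
  show "J \<circ> transpose i s \<in> inj_maps L A" if "J \<in> inj_maps L A" for J
  proof -
    have "inj_on (J \<circ> transpose i s) L"
      using that assms comp_inj_on[of "transpose i s" L J] by (simp add: inj_maps_def)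
    then show ?thesis
      using that tr by (auto simp: inj_maps_def PiE_def Pi_def extensional_def)
  qed
  then show "J \<circ> transpose i s \<in> inj_maps L A" if "J \<in> inj_maps L A" for J
    using that by blast
qed (auto simp: comp_assoc)

text \<open>Exchanging two rows permutes the injections. The \<open>restrict\<close> keeps the maps
  extensional, since \<open>transpose i s\<close> could move the value
  \<open>undefined\<close>.\<close>

lemma sum_inj_maps_transpose_left:
  assumes "i \<in> A" "s \<in> A" 
  shows "(\<Sum>J\<in>inj_maps L A. g (restrict (transpose i s \<circ> J) L)) = (\<Sum>J\<in>inj_maps L A. g J)"
proof (rule sum.reindex_bij_witness[where i = "\<lambda>J. restrict (transpose i s \<circ> J) L"
        and j = "\<lambda>J. restrict (transpose i s \<circ> J) L"])
  have tr: "transpose i s l \<in> A \<longleftrightarrow> l \<in> A" for l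
    using assms by (auto simp: transpose_def)
  show "restrict (transpose i s \<circ> J) L \<in> inj_maps L A" if "J \<in> inj_maps L A" for J
    using that tr by (auto simp: inj_maps_def PiE_def Pi_def inj_on_def dest: transpose_eq_imp_eq)
  then show "restrict (transpose i s \<circ> J) L \<in> inj_maps L A" if "J \<in> inj_maps L A" for J
    using that by blast
  show "restrict (transpose i s \<circ> restrict (transpose i s \<circ> J) L) L = J" if "J \<in> inj_maps L A" for J
    using that by (auto simp: inj_maps_def fun_eq_iff restrict_def PiE_def extensional_def)
  then show "restrict (transpose i s \<circ> restrict (transpose i s \<circ> J) L) L = J" if "J \<in> inj_maps L A" for J
    using that by blast
qed auto

section \<open>Permanents and the second difference identity\<close>

definition per :: "'a set \<Rightarrow> 'b set \<Rightarrow> ('a \<Rightarrow> 'b \<Rightarrow> 'c::comm_semiring_1) \<Rightarrow> 'c" where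
  "per A L z = (\<Sum>J\<in>inj_maps L A. \<Prod>l\<in>L. z (J l) l)"

text \<open>When the row of column \<open>s\<close> is drawn last, a sum over the free rows is
  compared with a sum over all rows. The outcome is a sum of terms \<open>z j s - z (J i) s\<close>,
  which are antisymmetric under exchange of the rows at \<open>i\<close> and \<open>s\<close>;
  symmetrising makes it quadratic in row differences.\<close>

lemma per_diff_identity:
  fixes z :: "'a \<Rightarrow> 'b \<Rightarrow> 'c::field_char_0"
  assumes "finite L" "finite A" "s \<notin> L" "card L \<le> card A"
  shows "of_nat (card A) * per A (insert s L) z
           - (of_nat (card A) - of_nat (card L)) * (\<Sum>j\<in>A. z j s) * per A L z
         = - (1 / 2) * (\<Sum>r\<in>L. \<Sum>u\<in>A. \<Sum>v\<in>A - {u}.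
               (z u r - z v r) * (z u s - z v s) * per (A - {u, v}) (L - {r}) z)"
proof -
  let ?p = "\<lambda>K J. \<Prod>l\<in>K. z (J l) l"
  let ?I = "inj_maps (insert s L) A"
  have upd: "?p L (J(s := j)) = ?p L J" for J j
    using assms(3) by (intro prod.cong) auto
  have "of_nat (card A) * per A (insert s L) z
           - (of_nat (card A) - of_nat (card L)) * (\<Sum>j\<in>A. z j s) * per A L z
      = (\<Sum>J\<in>inj_maps L A. ?p L J *
           (of_nat (card A) * (\<Sum>j\<in>A - J ` L. z j s)
             - (of_nat (card A) - of_nat (card L)) * (\<Sum>j\<in>A. z j s)))"
    using assms
    by (simp add: per_def sum_inj_maps_insert' upd fun_upd_same sum_distrib_left sum_distrib_right
        right_diff_distrib sum_subtractf mult_ac del: fun_upd_apply)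
  \<comment> \<open>Let \<open>N\<close> and \<open>k\<close> be the sizes of \<open>A\<close> and
    \<open>L\<close>, and let the free and the used rows contribute \<open>f\<close> and
    \<open>g\<close>. Then \<open>N * f - (N - k) * (f + g) = k * f - (N - k) * g\<close>, and there
    are \<open>N - k\<close> free and \<open>k\<close> used rows.\<close>
  also have "\<dots> = (\<Sum>J\<in>inj_maps L A. ?p L J * (\<Sum>j\<in>A - J ` L. \<Sum>i\<in>L. z j s - z (J i) s))"
  proof (intro sum.cong refl arg_cong2[where f = "(*)"])
    fix J assume J: "J \<in> inj_maps L A"
    then have *: "J ` L \<subseteq> A" "card (J ` L) = card L" "inj_on J L"
      by (auto simp: inj_maps_def card_image)
    then have "card (A - J ` L) = card A - card L"
      using assms by (simp add: card_Diff_subset)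
    then have c: "of_nat (card (A - J ` L)) = (of_nat (card A) - of_nat (card L) :: 'c)"
      using assms(4) by (simp add: of_nat_diff)
    have "(\<Sum>j\<in>A. z j s) = (\<Sum>j\<in>A - J ` L. z j s) + (\<Sum>j\<in>J ` L. z j s)"
      using * assms(2) by (simp add: sum.subset_diff)
    also have "(\<Sum>j\<in>J ` L. z j s) = (\<Sum>i\<in>L. z (J i) s)"
      using * by (simp add: sum.reindex)
    finally have e: "(\<Sum>j\<in>A. z j s) = (\<Sum>j\<in>A - J ` L. z j s) + (\<Sum>i\<in>L. z (J i) s)" .
    show "of_nat (card A) * (\<Sum>j\<in>A - J ` L. z j s)
             - (of_nat (card A) - of_nat (card L)) * (\<Sum>j\<in>A. z j s)
          = (\<Sum>j\<in>A - J ` L. \<Sum>i\<in>L. z j s - z (J i) s)"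
      unfolding e by (simp add: sum_subtractf c algebra_simps flip: sum_distrib_left)
  qed
  \<comment> \<open>The drawn row \<open>j\<close> becomes the value at \<open>s\<close> of an
    injection on \<open>insert s L\<close>, so that \<open>r\<close> and \<open>s\<close> can be
    exchanged.\<close>
  also have "\<dots> = (\<Sum>J\<in>?I. ?p L J * (\<Sum>i\<in>L. z (J s) s - z (J i) s))"
  proof -
    have "(\<Sum>i\<in>L. z j s - z ((J(s := j)) i) s) = (\<Sum>i\<in>L. z j s - z (J i) s)" for J j
      using assms(3) by (intro sum.cong) auto
    then show ?thesis
      using assms
      by (simp add: sum_inj_maps_insert' upd fun_upd_same del: fun_upd_apply)
         (simp add: sum_distrib_left)
  qed
  also have "\<dots> = (\<Sum>r\<in>L. \<Sum>J\<in>?I. ?p L J * (z (J s) s - z (J r) s))"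
    by (subst sum.swap) (simp add: sum_distrib_left)
  also have "\<dots> = (\<Sum>r\<in>L. - (1 / 2) * (\<Sum>u\<in>A. \<Sum>v\<in>A - {u}.
               (z u r - z v r) * (z u s - z v s) * per (A - {u, v}) (L - {r}) z))"
  proof (intro sum.cong refl)
    fix r assume r: "r \<in> L"
    then have rs: "r \<noteq> s" "s \<notin> L - {r}" using assms(3) by auto
    let ?q = "?p (L - {r})"
    have pq: "?p L J = z (J r) r * ?q J" for J
      using r assms(1) by (simp add: prod.remove)
    let ?g = "\<lambda>J. z (J r) r * ?q J * (z (J s) s - z (J r) s)"
    have tq: "?q (J \<circ> transpose r s) = ?q J" for J
      using rs assms(3) by (intro prod.cong) (auto simp: transpose_def)
    \<comment> \<open>Exchanging the values of \<open>J\<close> at \<open>r\<close> and \<open>s\<close> preserves the sum; averaging both forms produces the second difference.\<close>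
    have "2 * (\<Sum>J\<in>?I. ?g J) = (\<Sum>J\<in>?I. ?g J) + (\<Sum>J\<in>?I. ?g (J \<circ> transpose r s))"
      using r by (subst sum_inj_maps_transpose) auto
    also have "\<dots> = (\<Sum>J\<in>?I. - ((z (J r) r - z (J s) r) * (z (J r) s - z (J s) s) * ?q J))"
      unfolding tq by (subst sum.distrib[symmetric], intro sum.cong) (auto simp: algebra_simps)
    also have "\<dots> = - (\<Sum>J\<in>inj_maps (insert r (insert s (L - {r}))) A.
        (z (J r) r - z (J s) r) * (z (J r) s - z (J s) s) * ?q J)"
    proof -
      have "insert s L = insert r (insert s (L - {r}))" using r by auto
      then show ?thesis by (simp add: sum_negf)
    qed
    also have "\<dots> = - (\<Sum>u\<in>A. \<Sum>v\<in>A - {u}. \<Sum>J\<in>inj_maps (L - {r}) (A - {u} - {v}).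
        (z u r - z v r) * (z u s - z v s) * ?q J)"
    proof -
      have "?q (J(s := v, r := u)) = ?q J" for J u v
        using rs by (intro prod.cong) auto
      then show ?thesis
        using assms rs by (simp add: sum_inj_maps_insert)
    qed
    also have "\<dots> = - (\<Sum>u\<in>A. \<Sum>v\<in>A - {u}.
               (z u r - z v r) * (z u s - z v s) * per (A - {u, v}) (L - {r}) z)"
    proof -
      have "A - {u, v} = A - {u} - {v}" for u v by auto
      then show ?thesis by (simp add: per_def sum_distrib_left)
    qed
    finally have "2 * (\<Sum>J\<in>?I. ?g J) = - (\<Sum>u\<in>A. \<Sum>v\<in>A - {u}.
               (z u r - z v r) * (z u s - z v s) * per (A - {u, v}) (L - {r}) z)" .
    then show "(\<Sum>J\<in>?I. ?p L J * (z (J s) s - z (J r) s)) = - (1 / 2) * (\<Sum>u\<in>A. \<Sum>v\<in>A - {u}.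
               (z u r - z v r) * (z u s - z v s) * per (A - {u, v}) (L - {r}) z)"
      unfolding pq by (simp add: field_simps)
  qed
  finally show ?thesis
    by (simp add: sum_distrib_left)
qed

section \<open>Smoothing\<close>

text \<open>The T-transform of majorisation theory: a convex combination of the matrix with its copy
  in which rows \<open>i\<close> and \<open>s\<close> are exchanged. All other rows stay
  fixed.\<close>

definition t_transform :: "real \<Rightarrow> 'a \<Rightarrow> 'a \<Rightarrow> ('a \<Rightarrow> 'b \<Rightarrow> real) \<Rightarrow> 'a \<Rightarrow> 'b \<Rightarrow> real" where
  "t_transform t i s a = (\<lambda>j l. (1 - t) * a j l + t * a (transpose i s j) l)"

text \<open>The rows in \<open>B\<close> already equal \<open>m\<close>, and row \<open>x\<close> is
  mixed with one of them after the other. Finitely many mixings reach the exact mean, without a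
  limit argument.\<close>

lemma smoothing_step:
  fixes F :: "('a \<Rightarrow> 'b \<Rightarrow> real) \<Rightarrow> real"
  assumes mono: "\<And>a i s t. (\<And>j l. 0 \<le> a j l) \<Longrightarrow> i \<in> A \<Longrightarrow> s \<in> A \<Longrightarrow> i \<noteq> s \<Longrightarrow> 0 \<le> t \<Longrightarrow> t \<le> 1 \<Longrightarrow>
                   F a \<le> F (t_transform t i s a)"
    and "finite B" "B \<subseteq> A" "x \<in> A" "x \<notin> B" "\<And>j l. 0 \<le> a j l" "\<And>j. j \<in> B \<Longrightarrow> a j = m"
  shows "F a \<le> F (\<lambda>j l. if j \<in> insert x B then (real (card B) * m l + a x l) / (real (card B) + 1) else a j l)"
  using assms(2-)
proof (induction B arbitrary: a rule: finite_induct)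
  case empty
  have *: "(\<lambda>j l. if j \<in> insert x {} then (real (card {}) * m l + a x l) / (real (card {}) + 1) else a j l) = a"
    by (auto simp: fun_eq_iff)
  show ?case unfolding * by (rule order_refl)
next
  case (insert i B)
  define q where "q = real (card B)"
  have q: "0 \<le> q" by (simp add: q_def)
  \<comment> \<open>With this \<open>t\<close> row \<open>i\<close> reaches the final mean in one step, and the rest keeps that mean.\<close>
  define t where "t = 1 / (q + 2)"
  define a' where "a' = t_transform t i x a"
  have t: "0 \<le> t" "t \<le> 1" using q by (auto simp: t_def field_simps)
  have tq: "t * (q + 2) = 1" using q by (simp add: t_def)
  have "i \<noteq> x" using insert.prems by blast
  have "F a \<le> F a'"
    unfolding a'_def using insert.prems t \<open>i \<noteq> x\<close> by (intro mono) blast+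
  also have "F a' \<le> F (\<lambda>j l. if j \<in> insert x B then (real (card B) * m l + a' x l) / (real (card B) + 1) else a' j l)"
  proof (rule insert.IH)
    show "0 \<le> a' j l" for j l
      using t insert.prems(4) by (simp add: a'_def t_transform_def)
    show "a' j = m" if "j \<in> B" for j
    proof -
      have "j \<noteq> i" "j \<noteq> x" using that insert.prems insert.hyps by blast+
      then show ?thesis
        using insert.prems(5)[of j] that by (simp add: a'_def t_transform_def algebra_simps)
    qed
  qed (use insert.prems in blast)+
  also have "(\<lambda>j l. if j \<in> insert x B then (real (card B) * m l + a' x l) / (real (card B) + 1) else a' j l)
     = (\<lambda>j l. if j \<in> insert x (insert i B) then (real (card (insert i B)) * m l + a x l) / (real (card (insert i B)) + 1) else a j l)"
  proof (intro ext)
    fix j l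
    have c: "real (card (insert i B)) = q + 1"
      using insert.hyps by (simp add: q_def)
    have ai: "a i = m" by (rule insert.prems) simp
    have a'x: "a' x l = (1 - t) * a x l + t * m l"
      by (simp add: a'_def t_transform_def ai)
    have a'i: "a' i l = (1 - t) * m l + t * a x l"
      by (simp add: a'_def t_transform_def ai)
    have "a' j l = a j l" if "j \<noteq> x" "j \<noteq> i"
      using that by (simp add: a'_def t_transform_def algebra_simps)
    moreover have "a' i l = ((q + 1) * m l + a x l) / (q + 1 + 1)"
    proof -
      have "a' i l * (q + 1 + 1) = (q + 1) * m l + a x l"
        unfolding a'i using tq by algebra
      then show ?thesis using q by (simp add: eq_divide_eq)
    qed
    moreover have "(q * m l + a' x l) / (q + 1) = ((q + 1) * m l + a x l) / (q + 1 + 1)"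
    proof -
      have "(q * m l + a' x l) * (q + 1 + 1) = ((q + 1) * m l + a x l) * (q + 1)"
        unfolding a'x using tq by algebra
      then show ?thesis using q by (simp add: frac_eq_eq)
    qed
    ultimately show "(if j \<in> insert x B then (real (card B) * m l + a' x l) / (real (card B) + 1) else a' j l)
     = (if j \<in> insert x (insert i B) then (real (card (insert i B)) * m l + a x l) / (real (card (insert i B)) + 1) else a j l)"
      unfolding c q_def[symmetric] using \<open>i \<noteq> x\<close> insert.hyps by auto
  qed
  finally show ?case .
qed

text \<open>The block of equal rows grows by one row at a time through
  \<open>smoothing_step\<close>. It is used with \<open>B = A\<close>, where all rows become equal
  and \<open>F\<close> can be evaluated.\<close>

lemma smoothing:
  fixes F :: "('a \<Rightarrow> 'b \<Rightarrow> real) \<Rightarrow> real"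
  assumes mono: "\<And>a i s t. (\<And>j l. 0 \<le> a j l) \<Longrightarrow> i \<in> A \<Longrightarrow> s \<in> A \<Longrightarrow> i \<noteq> s \<Longrightarrow> 0 \<le> t \<Longrightarrow> t \<le> 1 \<Longrightarrow>
                   F a \<le> F (t_transform t i s a)"
    and "finite B" "B \<subseteq> A" "\<And>j l. 0 \<le> a j l"
  shows "F a \<le> F (\<lambda>j l. if j \<in> B then (\<Sum>j\<in>B. a j l) / real (card B) else a j l)"
  using assms(2-)
proof (induction B rule: finite_induct)
  case (insert x B)
  define m where "m = (\<lambda>l. (\<Sum>j\<in>B. a j l) / real (card B))"
  let ?b = "\<lambda>j l. if j \<in> B then m l else a j l"
  have "F a \<le> F ?b"
    unfolding m_def using insert by auto
  also have "\<dots> \<le> F (\<lambda>j l. if j \<in> insert x B then (real (card B) * m l + ?b x l) / (real (card B) + 1) else ?b j l)"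
    using insert by (intro smoothing_step[OF mono]) (auto simp: m_def sum_nonneg fun_eq_iff)
  also have "(\<lambda>j l. if j \<in> insert x B then (real (card B) * m l + ?b x l) / (real (card B) + 1) else ?b j l)
    = (\<lambda>j l. if j \<in> insert x B then (\<Sum>j\<in>insert x B. a j l) / real (card (insert x B)) else a j l)"
  proof -
    \<comment> \<open>For empty \<open>B\<close> the mean \<open>m l\<close> is \<open>0\<close> by
      division by zero, and both sides vanish.\<close>
    have "real (card B) * m l = (\<Sum>j\<in>B. a j l)" for l
      using insert by (cases "B = {}") (auto simp: m_def)
    then show ?thesis using insert by (auto simp: fun_eq_iff add_ac)
  qed
  finally show ?case .
qed simp

section \<open>The Carlen-Lieb-Loss inequality\<close>

lemma sqrt_mult_convex_le:
  fixes a b c d t :: real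
  assumes "0 \<le> a" "0 \<le> b" "0 \<le> c" "0 \<le> d" "0 \<le> t" "t \<le> 1"
  shows "(1 - t) * (sqrt a * sqrt b) + t * (sqrt c * sqrt d)
           \<le> sqrt ((1 - t) * a + t * c) * sqrt ((1 - t) * b + t * d)"
proof -
  define p q r s where "p = sqrt a" and "q = sqrt b" and "r = sqrt c" and "s = sqrt d"
  have eq: "a = p\<^sup>2" "b = q\<^sup>2" "c = r\<^sup>2" "d = s\<^sup>2"
    using assms by (simp_all add: p_def q_def r_def s_def)
  \<comment> \<open>Lagrange's identity: Cauchy-Schwarz for two weighted terms with its defect made
    explicit.\<close>
  have "((1 - t) * p\<^sup>2 + t * r\<^sup>2) * ((1 - t) * q\<^sup>2 + t * s\<^sup>2)
          = ((1 - t) * (p * q) + t * (r * s))\<^sup>2 + (1 - t) * t * (p * s - q * r)\<^sup>2"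
    by algebra
  moreover have "0 \<le> (1 - t) * t * (p * s - q * r)\<^sup>2"
    using assms by simp
  ultimately have "((1 - t) * (p * q) + t * (r * s))\<^sup>2 \<le> ((1 - t) * a + t * c) * ((1 - t) * b + t * d)"
    unfolding eq by linarith
  then show ?thesis
    unfolding p_def q_def r_def s_def real_sqrt_mult[symmetric] by (rule real_le_rsqrt)
qed

lemma convex_le_sqrt:
  fixes a c t :: real
  assumes "0 \<le> a" "0 \<le> c" "0 \<le> t" "t \<le> 1"
  shows "(1 - t) * sqrt a + t * sqrt c \<le> sqrt ((1 - t) * a + t * c)"
  using sqrt_mult_convex_le[of a 1 c 1 t] assms by simp

text \<open>By invariance under row exchange, the permanent is the average, with weights
  \<open>1 - t\<close> and \<open>t\<close>, of those of the matrix and its exchanged copy. This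
  average is compared with the transformed permanent one injection at a time.\<close>

lemma per_sqrt_t_transform:
  assumes "\<And>j l. 0 \<le> a j l" "i \<in> A" "s \<in> A" "i \<noteq> s" "0 \<le> t" "t \<le> 1" "finite L"
  shows "per A L (\<lambda>j l. sqrt (a j l)) \<le> per A L (\<lambda>j l. sqrt (t_transform t i s a j l))"
proof -
  let ?w = "\<lambda>J. \<Prod>l\<in>L. sqrt (a (J l) l)"
  let ?v = "\<lambda>J. \<Prod>l\<in>L. sqrt (a (transpose i s (J l)) l)"
  have "(\<Sum>J\<in>inj_maps L A. ?v J) = (\<Sum>J\<in>inj_maps L A. ?w J)"
    by (subst (2) sum_inj_maps_transpose_left[OF assms(2,3), symmetric]) simp
  then have "per A L (\<lambda>j l. sqrt (a j l)) = (\<Sum>J\<in>inj_maps L A. (1 - t) * ?w J + t * ?v J)"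
    by (simp add: per_def sum.distrib flip: sum_distrib_left) (simp add: algebra_simps)
  also have "\<dots> \<le> (\<Sum>J\<in>inj_maps L A. \<Prod>l\<in>L. sqrt (t_transform t i s a (J l) l))"
  proof (rule sum_mono)
    fix J assume "J \<in> inj_maps L A"
    then have inj: "inj_on J L" by (simp add: inj_maps_def)
    define L0 where "L0 = {l \<in> L. J l \<in> {i, s}}"
    have fin: "finite L0" "L0 \<subseteq> L" using assms(7) by (auto simp: L0_def)
    have split: "(\<Prod>l\<in>L. g l) = (\<Prod>l\<in>L - L0. g l) * (\<Prod>l\<in>L0. g l)" for g :: "'b \<Rightarrow> real"
      using fin assms(7) by (intro prod.subset_diff) auto
    have r1: "(\<Prod>l\<in>L - L0. sqrt (a (transpose i s (J l)) l)) = (\<Prod>l\<in>L - L0. sqrt (a (J l) l))"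
      by (intro prod.cong) (auto simp: L0_def)
    have r2: "(\<Prod>l\<in>L - L0. sqrt (t_transform t i s a (J l) l)) = (\<Prod>l\<in>L - L0. sqrt (a (J l) l))"
      by (intro prod.cong) (auto simp: L0_def t_transform_def algebra_simps)
    \<comment> \<open>Injectivity leaves at most two factors that the transform can change. With one
      such factor concavity of the square root suffices, with two it is Cauchy-Schwarz.\<close>
    have "card L0 \<le> card {i, s}"
      using inj by (intro card_inj_on_le[of J]) (auto simp: L0_def inj_on_def)
    then have "card L0 = 0 \<or> card L0 = 1 \<or> card L0 = 2"
      using assms(4) by auto
    then have "(1 - t) * (\<Prod>l\<in>L0. sqrt (a (J l) l)) + t * (\<Prod>l\<in>L0. sqrt (a (transpose i s (J l)) l))
       \<le> (\<Prod>l\<in>L0. sqrt (t_transform t i s a (J l) l))"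
    proof (elim disjE)
      assume "card L0 = 0"
      then show ?thesis using fin by simp
    next
      assume "card L0 = 1"
      then obtain l where "L0 = {l}" by (auto simp: card_1_singleton_iff)
      then show ?thesis
        using assms by (simp add: t_transform_def convex_le_sqrt)
    next
      assume "card L0 = 2"
      then obtain l m where "L0 = {l, m}" "l \<noteq> m" by (auto simp: card_2_iff)
      then show ?thesis
        using assms by (simp add: t_transform_def sqrt_mult_convex_le)
    qed
    then have "(\<Prod>l\<in>L - L0. sqrt (a (J l) l)) * ((1 - t) * (\<Prod>l\<in>L0. sqrt (a (J l) l)) + t * (\<Prod>l\<in>L0. sqrt (a (transpose i s (J l)) l)))
       \<le> (\<Prod>l\<in>L - L0. sqrt (a (J l) l)) * (\<Prod>l\<in>L0. sqrt (t_transform t i s a (J l) l))"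
      using assms by (intro mult_left_mono prod_nonneg) auto
    then show "(1 - t) * ?w J + t * ?v J \<le> (\<Prod>l\<in>L. sqrt (t_transform t i s a (J l) l))"
      unfolding split r1 r2 by (simp add: algebra_simps)
  qed
  finally show ?thesis by (simp add: per_def)
qed

text \<open>The inequality of Carlen, Lieb and Loss, in terms of the squared entries \<open>a\<close>.\<close>

lemma per_sqrt_le:
  fixes a :: "'a \<Rightarrow> 'b \<Rightarrow> real"
  assumes "finite A" "finite L" "\<And>j l. 0 \<le> a j l"
  shows "per A L (\<lambda>j l. sqrt (a j l))
           \<le> real (card (inj_maps L A)) * (\<Prod>l\<in>L. sqrt ((\<Sum>j\<in>A. a j l) / real (card A)))"
proof -
  let ?m = "\<lambda>l. (\<Sum>j\<in>A. a j l) / real (card A)"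
  have "per A L (\<lambda>j l. sqrt (a j l)) \<le> per A L (\<lambda>j l. sqrt (if j \<in> A then ?m l else a j l))"
    using assms
    by (intro smoothing[of A "\<lambda>a. per A L (\<lambda>j l. sqrt (a j l))"] per_sqrt_t_transform) auto
  also have "\<dots> = (\<Sum>J\<in>inj_maps L A. \<Prod>l\<in>L. sqrt (?m l))"
    unfolding per_def by (intro sum.cong prod.cong) (auto simp: inj_maps_def)
  finally show ?thesis by simp
qed

section \<open>Maclaurin's inequality for elementary symmetric polynomials\<close>

lemma maclaurin_t_transform:
  fixes a :: "'a \<Rightarrow> 'b \<Rightarrow> real"
  assumes "\<And>j l. 0 \<le> a j l" "i \<in> A" "s \<in> A" "i \<noteq> s" "0 \<le> t" "t \<le> 1" "finite A"
  shows "(\<Sum>R | R \<subseteq> A \<and> card R = q. \<Prod>j\<in>R. a j x) \<le> (\<Sum>R | R \<subseteq> A \<and> card R = q. \<Prod>j\<in>R. t_transform t i s a j x)"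
proof -
  let ?X = "{R. R \<subseteq> A \<and> card R = q}"
  let ?\<tau> = "transpose i s"
  have v: "(\<Prod>j\<in>?\<tau> ` R. a j x) = (\<Prod>j\<in>R. a (?\<tau> j) x)" for R
    by (simp add: prod.reindex)
  have tr: "?\<tau> l \<in> A \<longleftrightarrow> l \<in> A" for l
    using assms by (auto simp: transpose_def)
  have "(\<Sum>R\<in>?X. \<Prod>j\<in>?\<tau> ` R. a j x) = (\<Sum>R\<in>?X. \<Prod>j\<in>R. a j x)"
    by (rule sum.reindex_bij_witness[where i = "image ?\<tau>" and j = "image ?\<tau>"])
       (auto simp: image_image tr card_image)
  then have "(\<Sum>R\<in>?X. \<Prod>j\<in>R. a j x) = (\<Sum>R\<in>?X. (1 - t) * (\<Prod>j\<in>R. a j x) + t * (\<Prod>j\<in>R. a (?\<tau> j) x))"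
    by (simp add: v sum.distrib flip: sum_distrib_left) (simp add: algebra_simps)
  also have "\<dots> \<le> (\<Sum>R\<in>?X. \<Prod>j\<in>R. t_transform t i s a j x)"
  proof (rule sum_mono)
    fix R assume "R \<in> ?X"
    then have "finite R" using assms finite_subset by blast
    define R0 where "R0 = R \<inter> {i, s}"
    have split: "(\<Prod>l\<in>R. g l) = (\<Prod>l\<in>R - R0. g l) * (\<Prod>l\<in>R0. g l)" for g :: "'a \<Rightarrow> real"
      using \<open>finite R\<close> by (intro prod.subset_diff) (auto simp: R0_def)
    have r1: "(\<Prod>l\<in>R - R0. a (?\<tau> l) x) = (\<Prod>l\<in>R - R0. a l x)"
      by (intro prod.cong) (auto simp: R0_def)
    have r2: "(\<Prod>l\<in>R - R0. t_transform t i s a l x) = (\<Prod>l\<in>R - R0. a l x)"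
      by (intro prod.cong) (auto simp: R0_def t_transform_def algebra_simps)
    \<comment> \<open>One changed factor gives equality by linearity. If both rows occur, the
      product of the mixed entries exceeds the original one by
      \<open>(1 - t) * t * (a i x - a s x)\<^sup>2\<close>.\<close>
    have "R0 = {} \<or> R0 = {i} \<or> R0 = {s} \<or> R0 = {i, s}"
      by (auto simp: R0_def)
    then have "(1 - t) * (\<Prod>l\<in>R0. a l x) + t * (\<Prod>l\<in>R0. a (?\<tau> l) x) \<le> (\<Prod>l\<in>R0. t_transform t i s a l x)"
    proof (elim disjE)
      assume *: "R0 = {i, s}"
      have "0 \<le> (1 - t) * t * (a i x - a s x)\<^sup>2"
        using assms by simp
      then show ?thesis
        using assms * by (simp add: t_transform_def algebra_simps power2_eq_square)
    qed (auto simp: t_transform_def)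
    then have "(\<Prod>l\<in>R - R0. a l x) * ((1 - t) * (\<Prod>l\<in>R0. a l x) + t * (\<Prod>l\<in>R0. a (?\<tau> l) x))
        \<le> (\<Prod>l\<in>R - R0. a l x) * (\<Prod>l\<in>R0. t_transform t i s a l x)"
      using assms by (intro mult_left_mono prod_nonneg) auto
    then show "(1 - t) * (\<Prod>j\<in>R. a j x) + t * (\<Prod>j\<in>R. a (?\<tau> j) x) \<le> (\<Prod>j\<in>R. t_transform t i s a j x)"
      unfolding split r1 r2 by (simp add: algebra_simps)
  qed
  finally show ?thesis .
qed

text \<open>A vector is treated as a matrix with a single column, indexed by the unit type, so that
  \<open>smoothing\<close> applies. At the mean all products are the same power.\<close>

lemma maclaurin_subsets:
  fixes x :: "'a \<Rightarrow> real"
  assumes "finite A" "\<And>j. 0 \<le> x j"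
  shows "(\<Sum>R | R \<subseteq> A \<and> card R = q. \<Prod>j\<in>R. x j)
           \<le> real (card A choose q) * ((\<Sum>j\<in>A. x j) / real (card A)) ^ q"
proof -
  let ?F = "\<lambda>a. \<Sum>R | R \<subseteq> A \<and> card R = q. \<Prod>j\<in>R. a j ()"
  let ?m = "(\<Sum>j\<in>A. x j) / real (card A)"
  have "?F (\<lambda>j _. x j) \<le> ?F (\<lambda>j _. if j \<in> A then ?m else x j)"
    using assms by (intro smoothing[of A ?F A "\<lambda>j _. x j"] maclaurin_t_transform) auto
  also have "\<dots> = (\<Sum>R | R \<subseteq> A \<and> card R = q. ?m ^ q)"
  proof (intro sum.cong refl)
    fix R assume "R \<in> {R. R \<subseteq> A \<and> card R = q}"
    then have "R \<subseteq> A" "card R = q"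
      by auto
    moreover from this have "(\<Prod>j\<in>R. if j \<in> A then ?m else x j) = (\<Prod>j\<in>R. ?m)"
      by (intro prod.cong) auto
    ultimately show "(\<Prod>j\<in>R. if j \<in> A then ?m else x j) = ?m ^ q"
      by (simp only: prod_constant)
  qed
  finally show ?thesis
    using assms(1) by (simp add: n_subsets)
qed

section \<open>Averages over subsets of columns\<close>

abbreviation ksubsets :: "'a set \<Rightarrow> nat \<Rightarrow> 'a set set" where
  "ksubsets A k \<equiv> {S. S \<subseteq> A \<and> card S = k}"

text \<open>A set with a marked element corresponds to that element together with the rest of the
  set. Applied twice, this marks an ordered pair of columns.\<close>

lemma sum_ksubsets_Suc:
  assumes "finite A"
  shows "(\<Sum>S\<in>ksubsets A (Suc k). \<Sum>s\<in>S. g s (S - {s})) = (\<Sum>s\<in>A. \<Sum>L\<in>ksubsets (A - {s}) k. g s L)"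
proof -
  have fin: "finite S" if "S \<subseteq> A" for S
    using that assms finite_subset by blast
  have "(\<Sum>S\<in>ksubsets A (Suc k). \<Sum>s\<in>S. g s (S - {s})) =
        (\<Sum>(S, s)\<in>Sigma (ksubsets A (Suc k)) (\<lambda>S. S). g s (S - {s}))"
    using assms by (intro sum.Sigma) (auto intro: fin)
  also have "\<dots> = (\<Sum>(s, L)\<in>Sigma A (\<lambda>s. ksubsets (A - {s}) k). g s L)"
  proof (rule sum.reindex_bij_witness[where i = "\<lambda>(s, L). (insert s L, s)" and j = "\<lambda>(S, s). (s, S - {s})"])
    fix p assume "p \<in> Sigma A (\<lambda>s. ksubsets (A - {s}) k)"
    then obtain s L where p: "p = (s, L)" "s \<in> A" "L \<subseteq> A - {s}" "card L = k" by auto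
    then have "s \<notin> L" "finite L" using fin by auto
    with p show "(case p of (s, L) \<Rightarrow> (insert s L, s)) \<in> Sigma (ksubsets A (Suc k)) (\<lambda>S. S)"
      "(case case p of (s, L) \<Rightarrow> (insert s L, s) of (S, s) \<Rightarrow> (s, S - {s})) = p"
      by auto
  qed (auto intro: fin)
  also have "\<dots> = (\<Sum>s\<in>A. \<Sum>L\<in>ksubsets (A - {s}) k. g s L)"
    using assms by (intro sum.Sigma[symmetric]) auto
  finally show ?thesis .
qed

lemma sum_ksubsets_swap:
  assumes "finite A"
  shows "(\<Sum>s\<in>A. \<Sum>L\<in>ksubsets (A - {s}) k. g s L) = (\<Sum>L\<in>ksubsets A k. \<Sum>s\<in>A - L. g s L)"
proof -
  have "ksubsets (A - {s}) k = {L \<in> ksubsets A k. s \<notin> L}" for s by auto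
  moreover have "A - L = {s \<in> A. s \<notin> L}" for L by auto
  ultimately show ?thesis
    using assms by (simp only:) (intro sum.swap_restrict; simp)
qed

lemma sum_ksubsets_complement:
  assumes "finite A" "k \<le> card A"
  shows "(\<Sum>S\<in>ksubsets A k. g (A - S)) = (\<Sum>R\<in>ksubsets A (card A - k). g R)"
proof -
  have fin: "finite S" if "S \<subseteq> A" for S
    using that assms finite_subset by blast
  show ?thesis
    using assms
    by (intro sum.reindex_bij_witness[where i = "\<lambda>R. A - R" and j = "\<lambda>S. A - S"])
       (auto simp: card_Diff_subset fin double_diff)
qed

text \<open>The interpolation \<open>T k\<close>, with \<open>e\<close> standing for the normalised
  permanents and \<open>w\<close> for the column means. Keeping both abstract reduces its increments
  to counting subsets.\<close>

definition subset_mean :: "'b set \<Rightarrow> ('b set \<Rightarrow> 'c) \<Rightarrow> ('b \<Rightarrow> 'c) \<Rightarrow> nat \<Rightarrow> 'c::field_char_0" where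
  "subset_mean C e w k = (\<Sum>S\<in>ksubsets C k. e S * (\<Prod>l\<in>C - S. w l)) / of_nat (card C choose k)"

lemma subset_mean_0:
  "finite C \<Longrightarrow> subset_mean C e w 0 = e {} * (\<Prod>l\<in>C. w l)"
proof -
  assume "finite C"
  then have "ksubsets C 0 = {{}}" by (auto simp: finite_subset)
  then show ?thesis by (simp add: subset_mean_def)
qed

lemma subset_mean_card:
  "finite C \<Longrightarrow> subset_mean C e w (card C) = e C"
proof -
  assume "finite C"
  then have "ksubsets C (card C) = {C}" using card_subset_eq by blast
  then show ?thesis by (simp add: subset_mean_def)
qed

text \<open>Sets of size \<open>k + 1\<close> with a marked element and sets of size
  \<open>k\<close> with an added element both correspond to the pairs \<open>(s, L)\<close>. The
  weights agree because
  \<open>(k + 1) * (n choose (k + 1)) = (n - k) * (n choose k)\<close>.\<close>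

lemma subset_mean_diff:
  fixes C :: "'b set" and w :: "'b \<Rightarrow> 'c::field_char_0"
  assumes "finite C" "k < card C"
  shows "subset_mean C e w (Suc k) - subset_mean C e w k =
    (\<Sum>s\<in>C. \<Sum>L\<in>ksubsets (C - {s}) k. (e (insert s L) - w s * e L) * (\<Prod>l\<in>C - {s} - L. w l))
      / (of_nat (Suc k) * of_nat (card C choose Suc k))"
proof -
  let ?n = "card C"
  have "(\<Sum>s\<in>C. \<Sum>L\<in>ksubsets (C - {s}) k. e (insert s L) * (\<Prod>l\<in>C - {s} - L. w l))
     = (\<Sum>S\<in>ksubsets C (Suc k). \<Sum>s\<in>S. e (insert s (S - {s})) * (\<Prod>l\<in>C - {s} - (S - {s}). w l))"
    by (rule sum_ksubsets_Suc[OF assms(1), symmetric])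
  also have "\<dots> = (\<Sum>S\<in>ksubsets C (Suc k). \<Sum>s\<in>S. e S * (\<Prod>l\<in>C - S. w l))"
  proof (intro sum.cong refl)
    fix S and s :: 'b assume "s \<in> S"
    then have "insert s (S - {s}) = S" "C - {s} - (S - {s}) = C - S" by auto
    then show "e (insert s (S - {s})) * (\<Prod>l\<in>C - {s} - (S - {s}). w l) = e S * (\<Prod>l\<in>C - S. w l)"
      by simp
  qed
  also have "\<dots> = of_nat (Suc k) * (\<Sum>S\<in>ksubsets C (Suc k). e S * (\<Prod>l\<in>C - S. w l))"
    by (simp add: sum_distrib_left del: of_nat_Suc)
  finally have 1: "(\<Sum>s\<in>C. \<Sum>L\<in>ksubsets (C - {s}) k. e (insert s L) * (\<Prod>l\<in>C - {s} - L. w l)) = \<dots>" .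
  have "(\<Sum>s\<in>C. \<Sum>L\<in>ksubsets (C - {s}) k. w s * e L * (\<Prod>l\<in>C - {s} - L. w l))
     = (\<Sum>L\<in>ksubsets C k. \<Sum>s\<in>C - L. w s * e L * (\<Prod>l\<in>C - {s} - L. w l))"
    by (rule sum_ksubsets_swap[OF assms(1)])
  also have "\<dots> = (\<Sum>L\<in>ksubsets C k. \<Sum>s\<in>C - L. e L * (\<Prod>l\<in>C - L. w l))"
  proof (intro sum.cong refl)
    fix L and s :: 'b assume "s \<in> C - L"
    then have "(\<Prod>l\<in>C - L. w l) = w s * (\<Prod>l\<in>C - L - {s}. w l)"
      using assms(1) by (intro prod.remove) auto
    moreover have "C - L - {s} = C - {s} - L" by auto
    ultimately show "w s * e L * (\<Prod>l\<in>C - {s} - L. w l) = e L * (\<Prod>l\<in>C - L. w l)"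
      by (simp add: mult_ac)
  qed
  also have "\<dots> = of_nat (?n - k) * (\<Sum>L\<in>ksubsets C k. e L * (\<Prod>l\<in>C - L. w l))"
    using assms(1)
    by (auto simp: sum_distrib_left card_Diff_subset finite_subset[of _ C] intro!: sum.cong)
  finally have 2: "(\<Sum>s\<in>C. \<Sum>L\<in>ksubsets (C - {s}) k. w s * e L * (\<Prod>l\<in>C - {s} - L. w l)) = \<dots>" .
  have "Suc k * (?n choose Suc k) = (?n - k) * (?n choose k)"
    by (simp only: binomial_absorption binomial_absorb_comp)
  then have b: "of_nat (Suc k) * of_nat (?n choose Suc k) = (of_nat (?n - k) * of_nat (?n choose k) :: 'c)"
    by (metis of_nat_mult)
  have nz: "of_nat (?n choose k) \<noteq> (0::'c)" "of_nat (?n - k) \<noteq> (0::'c)" "of_nat (Suc k) \<noteq> (0::'c)"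
    using assms(2) by (simp_all del: of_nat_Suc)
  have "of_nat (?n - k) * x / (of_nat (Suc k) * of_nat (?n choose Suc k)) = x / of_nat (?n choose k)" for x :: 'c
    unfolding b using nz by (simp del: of_nat_diff)
  then show ?thesis
    unfolding left_diff_distrib sum_subtractf 1 2 diff_divide_distrib
    using nz by (simp add: subset_mean_def del: of_nat_Suc of_nat_diff binomial_Suc_Suc)
qed

text \<open>The quotient has the junk value \<open>0\<close> if \<open>card L > card A\<close>.\<close>

definition per_mean :: "'a set \<Rightarrow> 'b set \<Rightarrow> ('a \<Rightarrow> 'b \<Rightarrow> 'c::field_char_0) \<Rightarrow> 'c" where
  "per_mean A L z = per A L z / of_nat (card (inj_maps L A))"

text \<open>This is \<open>per_diff_identity\<close> after normalisation. The factor
  \<open>card A * (card A - 1)\<close> counts the rows for the columns \<open>r\<close> and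
  \<open>s\<close>; the factor \<open>2 * card A\<close> is the source of the gain
  \<open>1 / (2 * N)\<close>.\<close>

lemma per_mean_diff:
  fixes z :: "'a \<Rightarrow> 'b \<Rightarrow> 'c::field_char_0"
  assumes "finite L" "finite A" "s \<notin> L" "card L < card A"
  shows "per_mean A (insert s L) z - (\<Sum>j\<in>A. z j s) / of_nat (card A) * per_mean A L z
         = - (\<Sum>r\<in>L. \<Sum>u\<in>A. \<Sum>v\<in>A - {u}.
               (z u r - z v r) * (z u s - z v s) * per_mean (A - {u, v}) (L - {r}) z)
             / (2 * of_nat (card A) * (of_nat (card A) * (of_nat (card A) - 1)))"
proof -
  let ?N = "of_nat (card A) :: 'c" and ?c = "of_nat (card (inj_maps (insert s L) A)) :: 'c"
  have c: "?c = of_nat (card (inj_maps L A)) * (?N - of_nat (card L))"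
    using assms by (simp add: card_inj_maps_insert of_nat_diff)
  have pos: "?N \<noteq> 0" "of_nat (card (inj_maps L A)) \<noteq> (0::'c)" "?N - of_nat (card L) \<noteq> 0"
    using assms card_inj_maps_pos[of L A] by (auto simp flip: of_nat_diff)
  have cc: "per (A - {u, v}) (L - {r}) z = per_mean (A - {u, v}) (L - {r}) z * (?c / (?N * (?N - 1)))"
    if "r \<in> L" "u \<in> A" "v \<in> A - {u}" for r u v
  proof -
    obtain k where k: "card L = Suc k"
      using card_Suc_Diff1[OF assms(1) \<open>r \<in> L\<close>] by metis
    have k': "card (L - {r}) = k" using that(1) assms(1) k by simp
    \<comment> \<open>With \<open>card A = m + 2\<close> and \<open>card L = k + 1\<close>, both
      counts of injections involve the same \<open>fact (m - k)\<close>, which cancels.\<close>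
    obtain m where m: "card A = Suc (Suc m)" "k \<le> m"
    proof
      show "card A = Suc (Suc (card A - 2))" "k \<le> card A - 2" using assms(4) k by linarith+
    qed
    have "u \<noteq> v" using that(3) by auto
    then have m': "card (A - {u, v}) = m"
      using that assms(2) m(1) by (simp add: card_Diff_subset)
    let ?x = "card (inj_maps (insert s L) A)" and ?y = "card (inj_maps (L - {r}) (A - {u, v}))"
    have sL: "card (insert s L) = Suc (Suc k)"
      using assms(1,3) k by simp
    have "?x * fact (card A - card (insert s L)) = fact (card A)"
      using assms sL m by (intro card_inj_maps) auto
    then have x: "?x * fact (m - k) = fact (Suc (Suc m))"
      unfolding sL m(1) diff_Suc_Suc .
    have y: "fact m = ?y * fact (m - k)"
      using card_inj_maps[of "L - {r}" "A - {u, v}"] assms(1,2) k' m(2) m' by simp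
    have "?x * fact (m - k) = Suc (Suc m) * Suc m * ?y * fact (m - k)"
      unfolding x fact_Suc of_nat_id y mult.assoc ..
    then have "?x = card A * (card A - 1) * ?y"
      using m(1) by simp
    then have c': "?c = ?N * of_nat (card A - 1) * of_nat ?y"
      by (simp only: of_nat_mult)
    have N1: "?N - 1 = of_nat (card A - 1)" "of_nat (card A - 1) \<noteq> (0::'c)"
      using m(1) by (simp_all del: of_nat_Suc) simp
    have y0: "of_nat ?y \<noteq> (0::'c)"
    proof -
      have "0 < ?y" using assms(1,2) k' m(2) m' by (intro card_inj_maps_pos) auto
      then show ?thesis by (metis of_nat_eq_0_iff less_irrefl)
    qed
    have "x = x / y * (a * d * y / (a * d))" if "a \<noteq> 0" "d \<noteq> 0" "y \<noteq> 0" for a d x y :: 'c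
      using that nonzero_mult_div_cancel_left[of "a * d" y] by (metis nonzero_eq_divide_eq mult_eq_0_iff)
    from this[OF pos(1) N1(2) y0] show ?thesis
      unfolding per_mean_def c' N1(1) .
  qed
  let ?S = "\<Sum>r\<in>L. \<Sum>u\<in>A. \<Sum>v\<in>A - {u}.
               (z u r - z v r) * (z u s - z v s) * per_mean (A - {u, v}) (L - {r}) z"
  let ?S' = "\<Sum>r\<in>L. \<Sum>u\<in>A. \<Sum>v\<in>A - {u}.
               (z u r - z v r) * (z u s - z v s) * per (A - {u, v}) (L - {r}) z"
  have S: "?S' = ?S * (?c / (?N * (?N - 1)))"
    unfolding sum_distrib_right by (intro sum.cong refl) (simp only: cc mult.assoc)
  have "per_mean A (insert s L) z - (\<Sum>j\<in>A. z j s) / ?N * per_mean A L z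
     = (?N * per A (insert s L) z - (?N - of_nat (card L)) * (\<Sum>j\<in>A. z j s) * per A L z) / (?N * ?c)"
    unfolding per_mean_def c using pos by (simp add: diff_divide_distrib)
  also have "\<dots> = - (1 / 2) * (?S * (?c / (?N * (?N - 1)))) / (?N * ?c)"
    unfolding per_diff_identity[OF assms(1-3) less_imp_le[OF assms(4)], of z] S ..
  also have "\<dots> = - ?S / (2 * ?N * (?N * (?N - 1)))"
  proof -
    have "?c \<noteq> 0" using pos c by simp
    then have "- (1 / 2) * (x * (?c / y)) / (?N * ?c) = - x / (2 * ?N * y)" for x y
      by simp
    then show ?thesis .
  qed
  finally show ?thesis .
qed

text \<open>The triangle inequality replaces the entries by their moduli, and
  \<open>per_sqrt_le\<close> applies to the squares of these.\<close>

lemma norm_per_mean_le: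
  fixes z :: "'a \<Rightarrow> 'b \<Rightarrow> complex"
  assumes "finite A" "finite L" "card L \<le> card A"
  shows "norm (per_mean A L z) \<le> (\<Prod>l\<in>L. sqrt ((\<Sum>j\<in>A. (norm (z j l))\<^sup>2) / real (card A)))"
proof -
  have "norm (per A L z) \<le> per A L (\<lambda>j l. sqrt ((norm (z j l))\<^sup>2))"
    unfolding per_def by (rule sum_norm_le) (simp add: prod_norm)
  also have "\<dots> \<le> real (card (inj_maps L A)) * (\<Prod>l\<in>L. sqrt ((\<Sum>j\<in>A. (norm (z j l))\<^sup>2) / real (card A)))"
    using assms by (intro per_sqrt_le) auto
  finally show ?thesis
    using card_inj_maps_pos[OF assms(2,1,3)]
    by (simp add: per_mean_def norm_divide pos_divide_le_eq mult.commute)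
qed

section \<open>Estimate of one increment of the interpolation\<close>

lemma sum_mult_le_sqrt:
  fixes f g :: "'a \<Rightarrow> real"
  shows "(\<Sum>i\<in>I. f i * g i) \<le> sqrt (\<Sum>i\<in>I. (f i)\<^sup>2) * sqrt (\<Sum>i\<in>I. (g i)\<^sup>2)"
proof -
  have "(\<Sum>i\<in>I. f i * g i) \<le> (\<Sum>i\<in>I. \<bar>f i\<bar> * \<bar>g i\<bar>)"
    by (intro sum_mono) (simp flip: abs_mult)
  also have "\<dots> \<le> sqrt (\<Sum>i\<in>I. (f i)\<^sup>2) * sqrt (\<Sum>i\<in>I. (g i)\<^sup>2)"
    using L2_set_mult_ineq[of f g I] by (simp add: L2_set_def)
  finally show ?thesis .
qed

text \<open>In the step from \<open>k + 1\<close> to \<open>k + 2\<close> columns the inner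
  permanents have \<open>k\<close> columns. Cauchy-Schwarz is applied over the sets of these columns
  and then over the pairs \<open>(r, s)\<close>; Maclaurin's inequality bounds the second moments.
  For \<open>k = 0\<close> the constant \<open>K\<close> enters only as \<open>K ^ 0\<close>, so
  \<open>bound\<close> is asked for \<open>k > 0\<close>.\<close>

lemma norm_subset_mean_diff_le:
  fixes A :: "'a set" and C :: "'b set" and z :: "'a \<Rightarrow> 'b \<Rightarrow> complex"
  defines "w \<equiv> \<lambda>l. (\<Sum>j\<in>A. z j l) / of_nat (card A)"
    and "y \<equiv> \<lambda>r s. \<Sum>u\<in>A. \<Sum>v\<in>A - {u}. norm ((z u r - z v r) * (z u s - z v s))"
  assumes fin: "finite A" "finite C" and k: "Suc (Suc k) \<le> card C" and le: "card C \<le> card A"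
    and K: "0 \<le> K"
    and bound: "\<And>u v r s. u \<in> A \<Longrightarrow> v \<in> A - {u} \<Longrightarrow> s \<in> C \<Longrightarrow> r \<in> C - {s} \<Longrightarrow> k > 0 \<Longrightarrow>
       (\<Sum>j\<in>A - {u, v}. \<Sum>l\<in>C - {s} - {r}. (norm (z j l))\<^sup>2) \<le> (real (card C) - 2) * (real (card A) - 2) * K"
  shows "norm (subset_mean C (\<lambda>S. per_mean A S z) w (Suc (Suc k)) - subset_mean C (\<lambda>S. per_mean A S z) w (Suc k))
    \<le> sqrt (\<Sum>s\<in>C. \<Sum>r\<in>C - {s}. (y r s)\<^sup>2)
          / (real (card A) * (real (card A) - 1) * sqrt (real (card C) * (real (card C) - 1)))
        / (2 * real (card A)) *
        (real (Suc k) * sqrt ((\<Sum>l\<in>C. (norm (w l))\<^sup>2) / real (card C)) ^ (card C - Suc (Suc k)) * sqrt K ^ k)"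
proof -
  define N where "N = real (card A)"
  define n where "n = real (card C)"
  define B where "B = real (card C choose Suc (Suc k))"
  define B' where "B' = real ((card C - 2) choose k)"
  define \<beta> where "\<beta> = (\<Sum>l\<in>C. (norm (w l))\<^sup>2) / n"
  define q where "q = card C - Suc (Suc k)"
  \<comment> \<open>The mean square of column \<open>l\<close> without the rows \<open>u\<close> and
    \<open>v\<close>. If \<open>N = 2\<close>, division by zero makes it \<open>0\<close>; then
    \<open>k = 0\<close>, and only empty products of it matter.\<close>
  define b where "b = (\<lambda>u v l. (\<Sum>j\<in>A - {u, v}. (norm (z j l))\<^sup>2) / (N - 2))"
  define d where "d = (\<lambda>u v r s. norm ((z u r - z v r) * (z u s - z v s)))"
  let ?T = "subset_mean C (\<lambda>S. per_mean A S z) w"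
  have N: "N \<ge> 2" and n: "n \<ge> 2" using k le by (auto simp: N_def n_def)
  have b0: "0 \<le> b u v l" for u v l using N by (auto simp: b_def intro!: divide_nonneg_nonneg sum_nonneg)
  have finS: "finite S" if "S \<subseteq> C" for S using that fin finite_subset by blast
  have B: "B > 0" using k by (simp add: B_def)
  have B': "B' \<ge> 0" by (simp add: B'_def)
  \<comment> \<open>Both sides count the sets of \<open>k + 2\<close> columns with an ordered pair
    marked in them.\<close>
  have Beq: "B' * (n * (n - 1)) = real (Suc (Suc k)) * real (Suc k) * B"
  proof -
    obtain m where m: "card C = Suc (Suc m)"
    proof
      show "card C = Suc (Suc (card C - 2))" using k by linarith
    qed
    have "Suc (Suc k) * (Suc (Suc m) choose Suc (Suc k)) = Suc (Suc m) * (Suc m choose Suc k)"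
      using binomial_absorption[of "Suc k" "Suc (Suc m)"] unfolding diff_Suc_1 .
    moreover have "Suc k * (Suc m choose Suc k) = Suc m * (m choose k)"
      using binomial_absorption[of k "Suc m"] unfolding diff_Suc_1 .
    ultimately have "Suc k * (Suc (Suc k) * (Suc (Suc m) choose Suc (Suc k))) = Suc (Suc m) * (Suc m * (m choose k))"
      by (metis mult.left_commute)
    then have "real (Suc k) * (real (Suc (Suc k)) * B) = real (Suc (Suc m)) * (real (Suc m) * B')"
      unfolding B_def B'_def m diff_Suc_Suc diff_zero numeral_2_eq_2 of_nat_mult[symmetric] by (rule arg_cong)
    moreover have "n = real (Suc (Suc m))" "n - 1 = real (Suc m)"
      unfolding n_def m by simp_all
    ultimately show ?thesis
      by (simp only: mult_ac)
  qed
  \<comment> \<open>The contribution of the pair \<open>(r, s)\<close> and the set \<open>L\<close>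
    of the \<open>k\<close> columns left in the permanent; all other columns enter through their
    means.\<close>
  define h where "h = (\<lambda>r s L. (\<Sum>u\<in>A. \<Sum>v\<in>A - {u}. d u v r s * (\<Prod>l\<in>L. sqrt (b u v l))) * (\<Prod>l\<in>C - {s} - {r} - L. norm (w l)))"
  have step: "norm ((per_mean A (insert s L) z - w s * per_mean A L z) * (\<Prod>l\<in>C - {s} - L. w l))
     \<le> (\<Sum>r\<in>L. h r s (L - {r})) / (2 * N * (N * (N - 1)))"
    if "s \<in> C" "L \<subseteq> C - {s}" "card L = Suc k" for s L
  proof -
    have L: "finite L" "s \<notin> L" "card L < card A" using that finS k le by auto
    have r2: "norm (per_mean (A - {u, v}) (L - {r}) z) \<le> (\<Prod>l\<in>L - {r}. sqrt (b u v l))"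
      if "r \<in> L" "u \<in> A" "v \<in> A - {u}" for r u v
    proof -
      have "card (A - {u, v}) = card A - 2"
      proof -
        have "card {u, v} = 2" using that(3) by auto
        then show ?thesis using fin that by (subst card_Diff_subset) auto
      qed
      moreover have "card A \<ge> 2" using k le by simp
      moreover have "card (L - {r}) = k" using that L \<open>card L = Suc k\<close> by simp
      ultimately show ?thesis
        using norm_per_mean_le[of "A - {u, v}" "L - {r}" z] fin L k le
        by (simp add: b_def N_def of_nat_diff)
    qed
    have "norm (per_mean A (insert s L) z - w s * per_mean A L z)
        = norm (\<Sum>r\<in>L. \<Sum>u\<in>A. \<Sum>v\<in>A - {u}.
               (z u r - z v r) * (z u s - z v s) * per_mean (A - {u, v}) (L - {r}) z)
             / norm (2 * of_nat (card A) * (of_nat (card A) * (of_nat (card A) - 1)) :: complex)"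
      unfolding w_def per_mean_diff[OF L(1) fin(1) L(2,3)] norm_divide norm_minus_cancel ..
    also have "norm (2 * of_nat (card A) * (of_nat (card A) * (of_nat (card A) - 1)) :: complex)
        = 2 * N * (N * (N - 1))"
    proof -
      have "(2 * of_nat (card A) * (of_nat (card A) * (of_nat (card A) - 1)) :: complex)
        = of_real (2 * N * (N * (N - 1)))" by (simp add: N_def)
      then show ?thesis using N by (simp only: norm_of_real) simp
    qed
    also have "norm (\<Sum>r\<in>L. \<Sum>u\<in>A. \<Sum>v\<in>A - {u}.
               (z u r - z v r) * (z u s - z v s) * per_mean (A - {u, v}) (L - {r}) z)
       \<le> (\<Sum>r\<in>L. \<Sum>u\<in>A. \<Sum>v\<in>A - {u}. d u v r s * (\<Prod>l\<in>L - {r}. sqrt (b u v l)))"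
      by (intro sum_norm_le) (auto simp: norm_mult d_def intro!: mult_left_mono r2)
    finally have "norm (per_mean A (insert s L) z - w s * per_mean A L z)
      \<le> (\<Sum>r\<in>L. \<Sum>u\<in>A. \<Sum>v\<in>A - {u}. d u v r s * (\<Prod>l\<in>L - {r}. sqrt (b u v l))) / (2 * N * (N * (N - 1)))"
      using N by (simp add: divide_right_mono)
    then have "norm ((per_mean A (insert s L) z - w s * per_mean A L z) * (\<Prod>l\<in>C - {s} - L. w l))
      \<le> (\<Sum>r\<in>L. \<Sum>u\<in>A. \<Sum>v\<in>A - {u}. d u v r s * (\<Prod>l\<in>L - {r}. sqrt (b u v l))) / (2 * N * (N * (N - 1)))
         * (\<Prod>l\<in>C - {s} - L. norm (w l))"
      unfolding norm_mult prod_norm[symmetric] by (intro mult_right_mono prod_nonneg) auto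
    also have "\<dots> = (\<Sum>r\<in>L. (\<Sum>u\<in>A. \<Sum>v\<in>A - {u}. d u v r s * (\<Prod>l\<in>L - {r}. sqrt (b u v l)))
         * (\<Prod>l\<in>C - {s} - L. norm (w l))) / (2 * N * (N * (N - 1)))"
      by (simp add: sum_distrib_right)
    also have "\<dots> = (\<Sum>r\<in>L. h r s (L - {r})) / (2 * N * (N * (N - 1)))"
    proof -
      have "C - {s} - {r} - (L - {r}) = C - {s} - L" if "r \<in> L" for r using that by auto
      then show ?thesis by (simp add: h_def)
    qed
    finally show ?thesis .
  qed
  have "norm (?T (Suc (Suc k)) - ?T (Suc k))
     \<le> (\<Sum>s\<in>C. \<Sum>L\<in>ksubsets (C - {s}) (Suc k). (\<Sum>r\<in>L. h r s (L - {r})) / (2 * N * (N * (N - 1))))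
       / (real (Suc (Suc k)) * B)"
    unfolding subset_mean_diff[OF fin(2) Suc_le_lessD[OF k]] norm_divide norm_mult norm_of_nat B_def
    by (intro divide_right_mono sum_norm_le) (use step in auto)
  \<comment> \<open>Marking \<open>r\<close> in the old set \<open>L\<close> moves the pair
    \<open>(r, s)\<close> outside and leaves \<open>k\<close>-subsets of the other columns.\<close>
  also have "\<dots> = (\<Sum>s\<in>C. \<Sum>r\<in>C - {s}. \<Sum>L\<in>ksubsets (C - {s} - {r}) k. h r s L) / (2 * N * (N * (N - 1)))
       / (real (Suc (Suc k)) * B)"
  proof -
    have "(\<Sum>L\<in>ksubsets (C - {s}) (Suc k). \<Sum>r\<in>L. h r s (L - {r}))
        = (\<Sum>r\<in>C - {s}. \<Sum>L\<in>ksubsets (C - {s} - {r}) k. h r s L)" for s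
      using fin by (intro sum_ksubsets_Suc[where g = "\<lambda>r. h r s"]) simp
    then show ?thesis by (simp only: sum_divide_distrib[symmetric])
  qed
  finally have 1: "norm (?T (Suc (Suc k)) - ?T (Suc k)) \<le> \<dots>" .

  define H where "H = (\<lambda>r s. \<Sum>L\<in>ksubsets (C - {s} - {r}) k. \<Prod>l\<in>C - {s} - {r} - L. (norm (w l))\<^sup>2)"
  \<comment> \<open>First use of Cauchy-Schwarz, over \<open>L\<close> with rows and pair fixed. The
    resulting bound is free of \<open>u\<close> and \<open>v\<close>, so the sum of \<open>d\<close>
    over the rows gives \<open>y r s\<close>.\<close>
  have inner: "(\<Sum>L\<in>ksubsets (C - {s} - {r}) k. h r s L) \<le> y r s * (sqrt (B' * K ^ k) * sqrt (H r s))"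
    if "s \<in> C" "r \<in> C - {s}" for r s
  proof -
    let ?D = "C - {s} - {r}"
    have cD: "card ?D = card C - 2" using that fin by simp
    have "(\<Sum>L\<in>ksubsets ?D k. h r s L)
       = (\<Sum>u\<in>A. \<Sum>v\<in>A - {u}. d u v r s * (\<Sum>L\<in>ksubsets ?D k. (\<Prod>l\<in>L. sqrt (b u v l)) * (\<Prod>l\<in>?D - L. norm (w l))))"
      unfolding h_def sum_distrib_left sum_distrib_right
      by (subst sum.swap, rule sum.cong[OF refl], subst sum.swap) (simp add: mult.assoc)
    also have "\<dots> \<le> (\<Sum>u\<in>A. \<Sum>v\<in>A - {u}. d u v r s * (sqrt (B' * K ^ k) * sqrt (H r s)))"
    proof (intro sum_mono mult_left_mono)
      fix u v assume uv: "u \<in> A" "v \<in> A - {u}"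
      have "(\<Sum>L\<in>ksubsets ?D k. (\<Prod>l\<in>L. sqrt (b u v l)) * (\<Prod>l\<in>?D - L. norm (w l)))
        \<le> sqrt (\<Sum>L\<in>ksubsets ?D k. (\<Prod>l\<in>L. sqrt (b u v l))\<^sup>2) * sqrt (\<Sum>L\<in>ksubsets ?D k. (\<Prod>l\<in>?D - L. norm (w l))\<^sup>2)"
        by (rule sum_mult_le_sqrt)
      also have "(\<Sum>L\<in>ksubsets ?D k. (\<Prod>l\<in>?D - L. norm (w l))\<^sup>2) = H r s"
        by (simp add: H_def prod_power_distrib)
      also have "(\<Sum>L\<in>ksubsets ?D k. (\<Prod>l\<in>L. sqrt (b u v l))\<^sup>2) = (\<Sum>L\<in>ksubsets ?D k. \<Prod>l\<in>L. b u v l)"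
        by (simp add: b0 prod_power_distrib)
      also have "sqrt (\<Sum>L\<in>ksubsets ?D k. \<Prod>l\<in>L. b u v l) * sqrt (H r s) \<le> sqrt (B' * K ^ k) * sqrt (H r s)"
      proof (intro mult_right_mono real_sqrt_le_mono)
        \<comment> \<open>Maclaurin for the \<open>n - 2\<close> numbers \<open>b u v l\<close>,
          whose average is at most \<open>K\<close> by \<open>bound\<close> when
          \<open>k > 0\<close>.\<close>
        have "(\<Sum>L\<in>ksubsets ?D k. \<Prod>l\<in>L. b u v l) \<le> B' * ((\<Sum>l\<in>?D. b u v l) / real (card ?D)) ^ k"
          unfolding B'_def cD[symmetric] using fin b0 by (intro maclaurin_subsets) auto
        also have "\<dots> \<le> B' * K ^ k"
        proof (cases "k = 0")
          case False
          then have pos: "n - 2 > 0" "N - 2 > 0" using k le by (auto simp: n_def N_def)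
          have "(\<Sum>l\<in>?D. b u v l) = (\<Sum>j\<in>A - {u, v}. \<Sum>l\<in>?D. (norm (z j l))\<^sup>2) / (N - 2)"
            unfolding b_def sum_divide_distrib[symmetric] by (subst sum.swap) simp
          also have "\<dots> \<le> (n - 2) * (N - 2) * K / (N - 2)"
            using bound[OF uv that] False pos unfolding n_def N_def by (intro divide_right_mono) auto
          also have "\<dots> = (n - 2) * K" using pos by simp
          finally have "(\<Sum>l\<in>?D. b u v l) / (n - 2) \<le> K"
            using pos by (simp add: pos_divide_le_eq mult.commute)
          moreover have "real (card ?D) = n - 2" using k unfolding cD n_def by simp
          moreover have "0 \<le> (\<Sum>l\<in>?D. b u v l) / (n - 2)"
            using b0 pos by (intro divide_nonneg_nonneg sum_nonneg) auto
          ultimately show ?thesis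
            using B' by (intro mult_left_mono power_mono) auto
        qed simp
        finally show "(\<Sum>L\<in>ksubsets ?D k. \<Prod>l\<in>L. b u v l) \<le> B' * K ^ k" .
      qed (auto simp: H_def intro!: sum_nonneg prod_nonneg)
      finally show "(\<Sum>L\<in>ksubsets ?D k. (\<Prod>l\<in>L. sqrt (b u v l)) * (\<Prod>l\<in>?D - L. norm (w l)))
          \<le> sqrt (B' * K ^ k) * sqrt (H r s)" .
    qed (simp add: d_def)
    also have "\<dots> = y r s * (sqrt (B' * K ^ k) * sqrt (H r s))"
      by (simp add: y_def d_def sum_distrib_right)
    finally show ?thesis .
  qed

  have H0: "0 \<le> H r s" for r s
    by (auto simp: H_def intro!: sum_nonneg prod_nonneg)
  \<comment> \<open>Maclaurin for a single \<open>H r s\<close> would give a mean over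
    \<open>n - 2\<close> columns. Summing over all pairs first yields an elementary symmetric
    polynomial in all \<open>n\<close> columns, hence \<beta>.\<close>
  have "(\<Sum>s\<in>C. \<Sum>r\<in>C - {s}. H r s)
     = (\<Sum>S\<in>ksubsets C (Suc (Suc k)). \<Sum>s\<in>S. \<Sum>r\<in>S - {s}. \<Prod>l\<in>C - {s} - {r} - (S - {s} - {r}). (norm (w l))\<^sup>2)"
  proof -
    let ?g = "\<lambda>s S. \<Sum>r\<in>S. \<Prod>l\<in>C - {s} - {r} - (S - {r}). (norm (w l))\<^sup>2"
    have "(\<Sum>r\<in>C - {s}. H r s) = (\<Sum>S\<in>ksubsets (C - {s}) (Suc k). ?g s S)" for s
      unfolding H_def using fin
      by (intro sum_ksubsets_Suc[where g = "\<lambda>r L. \<Prod>l\<in>C - {s} - {r} - L. (norm (w l))\<^sup>2", symmetric]) simp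
    then show ?thesis
      using sum_ksubsets_Suc[OF fin(2), where g = ?g and k = "Suc k"] by (simp only:)
  qed
  also have "\<dots> = (\<Sum>S\<in>ksubsets C (Suc (Suc k)). \<Sum>s\<in>S. \<Sum>r\<in>S - {s}. \<Prod>l\<in>C - S. (norm (w l))\<^sup>2)"
  proof (intro sum.cong refl)
    fix S and s r :: 'b assume "s \<in> S" "r \<in> S - {s}"
    then have "C - {s} - {r} - (S - {s} - {r}) = C - S" by auto
    then show "(\<Prod>l\<in>C - {s} - {r} - (S - {s} - {r}). (norm (w l))\<^sup>2) = (\<Prod>l\<in>C - S. (norm (w l))\<^sup>2)"
      by simp
  qed
  also have "\<dots> = (\<Sum>S\<in>ksubsets C (Suc (Suc k)). real (Suc (Suc k)) * real (Suc k) * (\<Prod>l\<in>C - S. (norm (w l))\<^sup>2))"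
    by (intro sum.cong refl) (auto simp: finS)
  also have "\<dots> = real (Suc (Suc k)) * real (Suc k) * (\<Sum>R\<in>ksubsets C q. \<Prod>l\<in>R. (norm (w l))\<^sup>2)"
    unfolding q_def sum_distrib_left[symmetric] using fin k by (subst sum_ksubsets_complement) auto
  also have "\<dots> \<le> real (Suc (Suc k)) * real (Suc k) * (B * \<beta> ^ q)"
  proof -
    have "(\<Sum>R\<in>ksubsets C q. \<Prod>l\<in>R. (norm (w l))\<^sup>2) \<le> real (card C choose q) * \<beta> ^ q"
      unfolding \<beta>_def n_def using fin by (intro maclaurin_subsets) auto
    also have "card C choose q = card C choose Suc (Suc k)"
      unfolding q_def by (rule binomial_symmetric[OF k, symmetric])
    finally show ?thesis unfolding B_def by (intro mult_left_mono) auto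
  qed
  finally have sumH: "(\<Sum>s\<in>C. \<Sum>r\<in>C - {s}. H r s) \<le> B' * (n * (n - 1)) * \<beta> ^ q"
    unfolding Beq by (simp add: mult.assoc)

  \<comment> \<open>Second use of Cauchy-Schwarz, now over the ordered pairs of columns; it
    separates \<open>y\<close> from \<open>H\<close>.\<close>
  have "(\<Sum>s\<in>C. \<Sum>r\<in>C - {s}. \<Sum>L\<in>ksubsets (C - {s} - {r}) k. h r s L)
     \<le> (\<Sum>s\<in>C. \<Sum>r\<in>C - {s}. y r s * (sqrt (B' * K ^ k) * sqrt (H r s)))"
    by (intro sum_mono inner)
  also have "\<dots> = sqrt (B' * K ^ k) * (\<Sum>(s, r)\<in>Sigma C (\<lambda>s. C - {s}). y r s * sqrt (H r s))"
    using fin by (simp add: sum.Sigma sum_distrib_left mult_ac split_def)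
  also have "\<dots> \<le> sqrt (B' * K ^ k) * (sqrt (\<Sum>(s, r)\<in>Sigma C (\<lambda>s. C - {s}). (y r s)\<^sup>2) *
       sqrt (\<Sum>(s, r)\<in>Sigma C (\<lambda>s. C - {s}). (sqrt (H r s))\<^sup>2))"
    unfolding split_def using B' K by (intro mult_left_mono sum_mult_le_sqrt) auto
  also have "(\<Sum>(s, r)\<in>Sigma C (\<lambda>s. C - {s}). (sqrt (H r s))\<^sup>2) = (\<Sum>s\<in>C. \<Sum>r\<in>C - {s}. H r s)"
    using fin H0 by (simp add: sum.Sigma split_def)
  also have "(\<Sum>(s, r)\<in>Sigma C (\<lambda>s. C - {s}). (y r s)\<^sup>2) = (\<Sum>s\<in>C. \<Sum>r\<in>C - {s}. (y r s)\<^sup>2)"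
    using fin by (simp add: sum.Sigma split_def)
  also have "sqrt (B' * K ^ k) * (sqrt (\<Sum>s\<in>C. \<Sum>r\<in>C - {s}. (y r s)\<^sup>2) * sqrt (\<Sum>s\<in>C. \<Sum>r\<in>C - {s}. H r s))
      \<le> sqrt (B' * K ^ k) * (sqrt (\<Sum>s\<in>C. \<Sum>r\<in>C - {s}. (y r s)\<^sup>2) * sqrt (B' * (n * (n - 1)) * \<beta> ^ q))"
    using sumH B' K by (intro mult_left_mono real_sqrt_le_mono) (auto intro!: sum_nonneg)
  \<comment> \<open>Each use of Cauchy-Schwarz has supplied one factor
    \<open>sqrt B'\<close>.\<close>
  also have "\<dots> = sqrt (\<Sum>s\<in>C. \<Sum>r\<in>C - {s}. (y r s)\<^sup>2) * (B' * sqrt (n * (n - 1)) * (sqrt \<beta> ^ q * sqrt K ^ k))"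
    using B' by (simp add: real_sqrt_mult real_sqrt_power)
  finally have 2: "(\<Sum>s\<in>C. \<Sum>r\<in>C - {s}. \<Sum>L\<in>ksubsets (C - {s} - {r}) k. h r s L) \<le> \<dots>" .

  define Y where "Y = sqrt (\<Sum>s\<in>C. \<Sum>r\<in>C - {s}. (y r s)\<^sup>2)"
  define X where "X = sqrt \<beta> ^ q * sqrt K ^ k"
  define c where "c = sqrt (n * (n - 1))"
  have c: "c > 0" "n * (n - 1) = c * c" using n by (auto simp: c_def)
  \<comment> \<open>Thus \<open>B' * c / ((k + 2) * B) = (k + 1) / c\<close>, the source of the
    coefficients in \<open>f_poly\<close> and of the square root in the denominator of
    \<open>vartheta\<close>.\<close>
  have B'c: "B' = real (Suc (Suc k)) * real (Suc k) * B / (c * c)"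
    using Beq c by (simp add: eq_divide_eq)
  have "norm (?T (Suc (Suc k)) - ?T (Suc k))
     \<le> Y * (B' * c * X) / (2 * N * (N * (N - 1))) / (real (Suc (Suc k)) * B)"
    using 1 2 N B unfolding Y_def X_def c_def
    by (elim order_trans) (intro divide_right_mono; simp)
  also have "\<dots> = Y / (N * (N - 1) * c) / (2 * N) * (real (Suc k) * X)"
    unfolding B'c using c B N by (simp add: field_simps del: of_nat_Suc)
  finally show ?thesis
    unfolding Y_def X_def c_def N_def n_def \<beta>_def q_def by (simp only: mult.assoc)
qed

section \<open>The approximation theorem\<close>

lemma neq_pairs_eq_Sigma: "neq_pairs N = Sigma {1..N} (\<lambda>u. {1..N} - {u})"
  by (auto simp: neq_pairs_def)

lemma finite_neq_pairs: "finite (neq_pairs N)"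
  by (simp add: neq_pairs_eq_Sigma)

lemma sum_neq_pairs:
  "(\<Sum>(u, v)\<in>neq_pairs N. g u v) = (\<Sum>u\<in>{1..N}. \<Sum>v\<in>{1..N} - {u}. g u v)"
  unfolding neq_pairs_eq_Sigma by (rule sum.Sigma[symmetric]) auto

lemma per_mean_eq_Per:
  assumes "n \<le> N"
  shows "per_mean {1..N} {1..n} Z = fact (N - n) / fact N * Per N n Z"
proof -
  let ?c = "card (inj_maps {1..n} {1..N})"
  have "?c * fact (N - n) = fact N"
    using card_inj_maps[of "{1..n}" "{1..N}"] assms by simp
  then have "of_nat (?c * fact (N - n)) = (of_nat (fact N) :: complex)"
    by (rule arg_cong)
  then have "of_nat ?c * fact (N - n) = (fact N :: complex)"
    by simp
  moreover have "of_nat ?c \<noteq> (0 :: complex)"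
    using calculation by (metis fact_nonzero mult_zero_left)
  ultimately have "fact (N - n) / fact N = 1 / (of_nat ?c :: complex)"
    by (simp add: frac_eq_eq mult.commute)
  moreover have "Per N n Z = per {1..N} {1..n} Z"
    by (simp only: Per_def per_def inj_tuples_def inj_maps_def)
  ultimately show ?thesis
    by (simp add: per_mean_def)
qed

text \<open>A single row has the same mean drawn with or without replacement: for
  \<open>L = {}\<close> the right-hand side of \<open>per_mean_diff\<close> is an empty sum. Hence
  \<open>f_poly\<close> starts at \<open>k = 2\<close>.\<close>

lemma subset_mean_per_mean_1:
  fixes z :: "'a \<Rightarrow> 'b \<Rightarrow> 'c::field_char_0"
  assumes "finite A" "finite C" "card C > 0" "card A > 0"
  defines "w \<equiv> \<lambda>l. (\<Sum>j\<in>A. z j l) / of_nat (card A)"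
  shows "subset_mean C (\<lambda>S. per_mean A S z) w (Suc 0) = subset_mean C (\<lambda>S. per_mean A S z) w 0"
proof -
  have "per_mean A (insert s {}) z - w s * per_mean A {} z = 0" for s
    unfolding w_def using assms(1,4) by (subst per_mean_diff) auto
  moreover have "L = {}" if "L \<in> ksubsets (C - {s}) 0" for L s
    using that assms(2) finite_subset[of L "C - {s}"] by auto
  ultimately have "(\<Sum>s\<in>C. \<Sum>L\<in>ksubsets (C - {s}) 0.
      (per_mean A (insert s L) z - w s * per_mean A L z) * (\<Prod>l\<in>C - {s} - L. w l)) = 0"
    by (intro sum.neutral ballI) (metis mult_zero_left)
  then show ?thesis
    using subset_mean_diff[OF assms(2,3), of "\<lambda>S. per_mean A S z" w] by simp
qed

lemma kappa_bound:
  assumes "3 \<le> n" "n \<le> N" "(u, v) \<in> neq_pairs N" "(r, s) \<in> neq_pairs n"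
  shows "(\<Sum>j\<in>{1..N} - {u, v}. \<Sum>l\<in>{1..n} - {r, s}. (cmod (Z j l))\<^sup>2)
           \<le> (real n - 2) * (real N - 2) * kappa N n Z"
proof -
  let ?g = "\<lambda>((u, v), (r, s)). \<Sum>j\<in>{1..N} - {u, v}. \<Sum>l\<in>{1..n} - {r, s}. (cmod (Z j l))\<^sup>2"
  have "?g ((u, v), (r, s)) \<le> Max (?g ` (neq_pairs N \<times> neq_pairs n))"
    using assms by (intro Max_ge imageI) (auto simp: finite_neq_pairs)
  also have "\<dots> = (real n - 2) * (real N - 2) * kappa N n Z"
    using assms by (simp add: kappa_def)
  finally show ?thesis by simp
qed

lemma kappa_nonneg:
  assumes "n \<le> N"
  shows "0 \<le> kappa N n Z"
proof (cases "3 \<le> n")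
  case True
  \<comment> \<open>One index pair suffices: its sum of squares is nonnegative and lies below a
    positive multiple of \<open>kappa\<close>.\<close>
  then have "(1, 2) \<in> neq_pairs N" "(1, 2) \<in> neq_pairs n"
    using assms by (auto simp: neq_pairs_def)
  from kappa_bound[OF True assms this, of Z]
  have "0 \<le> (real n - 2) * (real N - 2) * kappa N n Z"
    by (rule order_trans[rotated]) (intro sum_nonneg zero_le_power2)
  moreover have "0 < (real n - 2) * (real N - 2)"
    using True assms by simp
  ultimately show ?thesis
    by (simp only: zero_le_mult_iff) linarith
qed (simp add: kappa_def)

text \<open>After the shift, \<open>k\<close> is the number of columns in the inner permanents, as
  in \<open>norm_subset_mean_diff_le\<close>.\<close>

lemma f_poly_eq: "f_poly n x1 x2 = (\<Sum>k<n - 1. real (Suc k) * x1 ^ (n - Suc (Suc k)) * x2 ^ k)"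
  unfolding f_poly_def
proof (rule sum.reindex_bij_witness[where i = "\<lambda>k. Suc (Suc k)" and j = "\<lambda>k. k - 2"])
  fix k assume "k \<in> {2..n}"
  then have "2 \<le> k" by simp
  then obtain m where "k = Suc (Suc m)"
    using le_Suc_ex[of 2 k] by auto
  then show "real (Suc (k - 2)) * x1 ^ (n - Suc (Suc (k - 2))) * x2 ^ (k - 2)
      = (real k - 1) * x1 ^ (n - k) * x2 ^ (k - 2)"
    by simp
qed auto

theorem theorem4p2:
  fixes N n :: nat and Z :: "nat \<Rightarrow> nat \<Rightarrow> complex"
  assumes "2 \<le> n" and "n \<le> N"
  shows "cmod (fact (N - n) / fact N * Per N n Z - (\<Prod>r=1..n. col_mean N Z r))
         \<le> vartheta N n Z / (2 * real N) * f_poly n (sqrt (beta N n Z)) (sqrt (kappa N n Z))"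
proof -
  let ?A = "{1..N}" and ?C = "{1..n}"
  define w where "w = (\<lambda>l. (\<Sum>j\<in>?A. Z j l) / of_nat (card ?A))"
  define T where "T = subset_mean ?C (\<lambda>S. per_mean ?A S Z) w"
  define Y where "Y = (\<Sum>s\<in>?C. \<Sum>r\<in>?C - {s}.
      (\<Sum>u\<in>?A. \<Sum>v\<in>?A - {u}. cmod ((Z u r - Z v r) * (Z u s - Z v s)))\<^sup>2)"
  have w: "w = col_mean N Z"
    by (simp add: w_def col_mean_def fun_eq_iff)
  \<comment> \<open>The double sums in \<open>vartheta\<close> and \<open>Y\<close> take the column
    pair in opposite orders; the summand is symmetric in it.\<close>
  have Y: "vartheta N n Z = sqrt Y / (real N * (real N - 1) * sqrt (real n * (real n - 1)))"
    by (simp add: vartheta_def Y_def sum_neq_pairs row_diff_def mult.commute)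
  have \<beta>: "beta N n Z = (\<Sum>l\<in>?C. (cmod (w l))\<^sup>2) / real n"
    by (simp add: beta_def w)
  have Tn: "T n = fact (N - n) / fact N * Per N n Z"
    using subset_mean_card[of ?C "\<lambda>S. per_mean ?A S Z" w] per_mean_eq_Per[OF assms(2)]
    by (simp add: T_def)
  have "per_mean ?A {} Z = 1"
    by (simp add: per_mean_def per_def)
  then have "T 0 = (\<Prod>r=1..n. col_mean N Z r)"
    by (simp add: T_def subset_mean_0 w)
  moreover have "T (Suc 0) = T 0"
    unfolding T_def w_def using assms by (intro subset_mean_per_mean_1) auto
  \<comment> \<open>Telescoping starts at \<open>T 1\<close>, so that the \<open>n - 1\<close>
    increments match the terms of \<open>f_poly\<close>.\<close>
  moreover have "(\<Sum>k<n - 1. T (Suc (Suc k)) - T (Suc k)) = T n - T (Suc 0)"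
    using sum_lessThan_telescope[of "\<lambda>k. T (Suc k)" "n - 1"] assms by simp
  ultimately have "cmod (fact (N - n) / fact N * Per N n Z - (\<Prod>r=1..n. col_mean N Z r))
      = cmod (\<Sum>k<n - 1. T (Suc (Suc k)) - T (Suc k))"
    by (simp add: Tn)
  also have "\<dots> \<le> (\<Sum>k<n - 1. vartheta N n Z / (2 * real N) *
      (real (Suc k) * sqrt (beta N n Z) ^ (n - Suc (Suc k)) * sqrt (kappa N n Z) ^ k))"
  proof (rule sum_norm_le)
    fix k assume "k \<in> {..<n - 1}"
    then have k: "Suc (Suc k) \<le> card ?C" by auto
    have K: "(\<Sum>j\<in>?A - {u, v}. \<Sum>l\<in>?C - {s} - {r}. (cmod (Z j l))\<^sup>2)
        \<le> (real (card ?C) - 2) * (real (card ?A) - 2) * kappa N n Z"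
      if "u \<in> ?A" "v \<in> ?A - {u}" "s \<in> ?C" "r \<in> ?C - {s}" "k > 0" for u v r s
    proof -
      \<comment> \<open>For \<open>k > 0\<close> the maximum in \<open>kappa\<close> is available;
        for \<open>n = 2\<close> only \<open>k = 0\<close> occurs.\<close>
      have "3 \<le> n" using k that(5) by simp
      moreover have "(u, v) \<in> neq_pairs N" "(s, r) \<in> neq_pairs n"
        using that by (auto simp: neq_pairs_def)
      moreover have "?C - {s} - {r} = ?C - {s, r}" by auto
      ultimately show ?thesis
        using kappa_bound[of n N u v s r Z] assms(2) by simp
    qed
    have "card ?C \<le> card ?A" using assms by simp
    from norm_subset_mean_diff_le[OF _ _ k this kappa_nonneg[OF assms(2)] K]
    show "cmod (T (Suc (Suc k)) - T (Suc k)) \<le> vartheta N n Z / (2 * real N) *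
      (real (Suc k) * sqrt (beta N n Z) ^ (n - Suc (Suc k)) * sqrt (kappa N n Z) ^ k)"
      unfolding T_def w_def Y Y_def \<beta> by simp
  qed
  also have "\<dots> = vartheta N n Z / (2 * real N) * f_poly n (sqrt (beta N n Z)) (sqrt (kappa N n Z))"
    unfolding f_poly_eq by (rule sum_distrib_left[symmetric])
  finally show ?thesis .
qed

end
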